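(* Let $m,n\geqslant1$, $N\geqslant1$, and let $\mathcal{J}\subseteq C_{m,n}(N)$ be the annihilator of the traceless subspace $V^{m,n}_0$ in $C_{m,n}(N)$. Then $\mathscr{P}_{m,n}$ is the splitting idempotent of the short exact sequence $0\to\mathcal{J}\to C_{m,n}(N)\to C_{m,n}(N)/\mathcal{J}\to0$: namely $\mathscr{P}_{m,n}C_{m,n}(N)$ and $\mathcal{J}$ are two-sided ideals with $C_{m,n}(N)=\mathscr{P}_{m,n}C_{m,n}(N)\oplus\mathcal{J}$ as a direct sum of algebras, and $\mathscr{P}_{m,n}C_{m,n}(N)\cong C_{m,n}(N)/\mathcal{J}$ as algebras.
   Context: $V$ is an $N$-dimensional complex vector space with basis $\{e_i\}$ and dual basis $\{e^i\}$; $V^{m,n}=V^{\otimes m}\otimes V^{*\otimes n}$ with the diagonal $GL(N)$-action (contragredient on $V^*$); $C_{m,n}(N)=\mathrm{End}_{GL(N)}(V^{m,n})$. $\mathrm{tr}_{ab'}:V^{m,n}\to V^{m-1,n-1}$ contracts the $a$-th $V$-factor with the $b'$-th $V^*$-factor and $\mathrm{tr}^+_{ab'}:V^{m-1,n-1}\to V^{m,n}$ inserts $\sum_ie_i\otimes e^i$ at these positions. $V^{m,n}_0=\bigcap_{a,b'}\ker\mathrm{tr}_{ab'}$, $V^{m,n}_1$ is the span of the images of all $\mathrm{tr}^+_{ab'}$, $V^{m,n}=V^{m,n}_0\oplus V^{m,n}_1$, and the traceless projector $\mathscr{P}_{m,n}$ is the projection onto $V^{m,n}_0$ with kernel $V^{m,n}_1$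 (it belongs to $C_{m,n}(N)$). *)

theory Defs
  imports Complex_Main "HOL-Library.Function_Algebras"
begin

text \<open>Concrete model. The basis of V^{m,n} is indexed by pairs (a,b) of lists of
  indices in {0..<N}, length a = m (the V-factors), length b = n (the V*-factors).
  Vectors are functions idx => complex vanishing outside the index set; endomorphisms
  are matrices idx => idx => complex vanishing outside idxs x idxs.\<close>

type_synonym idx = "nat list \<times> nat list"
type_synonym vec = "idx \<Rightarrow> complex"
type_synonym mat = "idx \<Rightarrow> idx \<Rightarrow> complex"

definition idxs :: "nat \<Rightarrow> nat \<Rightarrow> nat \<Rightarrow> idx set" where
  "idxs m n N = {(a,b). length a = m \<and> length b = n \<and> set a \<subseteq> {..<N} \<and> set b \<subseteq> {..<N}}"

definition vecs :: "nat \<Rightarrow> nat \<Rightarrow> nat \<Rightarrow> vec set" where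
  "vecs m n N = {v. \<forall>x. x \<notin> idxs m n N \<longrightarrow> v x = 0}"

definition mats :: "nat \<Rightarrow> nat \<Rightarrow> nat \<Rightarrow> mat set" where
  "mats m n N = {M. \<forall>x y. (x,y) \<notin> idxs m n N \<times> idxs m n N \<longrightarrow> M x y = 0}"

definition vadd :: "vec \<Rightarrow> vec \<Rightarrow> vec" where "vadd v w = (\<lambda>x. v x + w x)"
definition vsub :: "vec \<Rightarrow> vec \<Rightarrow> vec" where "vsub v w = (\<lambda>x. v x - w x)"
definition vzero :: vec where "vzero = (\<lambda>x. 0)"

definition madd :: "mat \<Rightarrow> mat \<Rightarrow> mat" where "madd A B = (\<lambda>x y. A x y + B x y)"
definition msmul :: "complex \<Rightarrow> mat \<Rightarrow> mat" where "msmul c A = (\<lambda>x y. c * A x y)"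
definition mzero :: mat where "mzero = (\<lambda>x y. 0)"

definition app :: "nat \<Rightarrow> nat \<Rightarrow> nat \<Rightarrow> mat \<Rightarrow> vec \<Rightarrow> vec" where
  "app m n N M v = (\<lambda>x. \<Sum>y\<in>idxs m n N. M x y * v y)"

definition mmul :: "nat \<Rightarrow> nat \<Rightarrow> nat \<Rightarrow> mat \<Rightarrow> mat \<Rightarrow> mat" where
  "mmul m n N A B = (\<lambda>x z. \<Sum>y\<in>idxs m n N. A x y * B y z)"

definition ident :: "nat \<Rightarrow> nat \<Rightarrow> nat \<Rightarrow> mat" where
  "ident m n N = (\<lambda>x y. if x \<in> idxs m n N \<and> x = y then 1 else 0)"

text \<open>GL(N): pairs (g,h) of N x N matrices with g h = 1 (so h = g^{-1}).\<close>
definition GL :: "nat \<Rightarrow> ((nat \<Rightarrow> nat \<Rightarrow> complex) \<times> (nat \<Rightarrow> nat \<Rightarrow> complex)) set" where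
  "GL N = {(g,h). \<forall>i<N. \<forall>j<N. (\<Sum>k<N. g i k * h k j) = (if i = j then 1 else 0)}"

text \<open>Diagonal action on V^{m,n}: g on each V-factor, contragredient (g^{-1})^T on each V*-factor.\<close>
definition rho :: "nat \<Rightarrow> nat \<Rightarrow> nat \<Rightarrow> (nat \<Rightarrow> nat \<Rightarrow> complex) \<Rightarrow> (nat \<Rightarrow> nat \<Rightarrow> complex) \<Rightarrow> mat" where
  "rho m n N g h = (\<lambda>(a,b) (a',b').
     if (a,b) \<in> idxs m n N \<and> (a',b') \<in> idxs m n N
     then (\<Prod>k<m. g (a!k) (a'!k)) * (\<Prod>l<n. h (b'!l) (b!l)) else 0)"

definition Cmn :: "nat \<Rightarrow> nat \<Rightarrow> nat \<Rightarrow> mat set" where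
  "Cmn m n N = {M \<in> mats m n N. \<forall>(g,h)\<in>GL N.
      mmul m n N M (rho m n N g h) = mmul m n N (rho m n N g h) M}"

definition ins :: "nat \<Rightarrow> nat \<Rightarrow> nat list \<Rightarrow> nat list" where
  "ins p i xs = take p xs @ i # drop p xs"

definition del :: "nat \<Rightarrow> nat list \<Rightarrow> nat list" where
  "del p xs = take p xs @ drop (Suc p) xs"

text \<open>tr_{ab'} (positions p, q counted from 0): V^{m,n} -> V^{m-1,n-1}.\<close>
definition tr :: "nat \<Rightarrow> nat \<Rightarrow> nat \<Rightarrow> nat \<Rightarrow> nat \<Rightarrow> vec \<Rightarrow> vec" where
  "tr m n N p q v = (\<lambda>(a,b). if (a,b) \<in> idxs (m-1) (n-1) N
      then (\<Sum>i<N. v (ins p i a, ins q i b)) else 0)"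

text \<open>tr^+_{ab'}: V^{m-1,n-1} -> V^{m,n}, inserting sum_i e_i (x) e^i at positions p, q.\<close>
definition trp :: "nat \<Rightarrow> nat \<Rightarrow> nat \<Rightarrow> nat \<Rightarrow> nat \<Rightarrow> vec \<Rightarrow> vec" where
  "trp m n N p q w = (\<lambda>(a,b). if (a,b) \<in> idxs m n N \<and> a!p = b!q
      then w (del p a, del q b) else 0)"

definition V0 :: "nat \<Rightarrow> nat \<Rightarrow> nat \<Rightarrow> vec set" where
  "V0 m n N = {v \<in> vecs m n N. \<forall>p<m. \<forall>q<n. tr m n N p q v = vzero}"

definition cscale :: "complex \<Rightarrow> vec \<Rightarrow> vec" where
  "cscale c v = (\<lambda>x. c * v x)"

definition V1 :: "nat \<Rightarrow> nat \<Rightarrow> nat \<Rightarrow> vec set" where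
  "V1 m n N = module.span cscale
     {trp m n N p q w | p q w. p < m \<and> q < n \<and> w \<in> vecs (m-1) (n-1) N}"

definition Pmn :: "nat \<Rightarrow> nat \<Rightarrow> nat \<Rightarrow> mat" where
  "Pmn m n N = (THE P. P \<in> mats m n N \<and>
     (\<forall>v\<in>vecs m n N. app m n N P v \<in> V0 m n N \<and> vsub v (app m n N P v) \<in> V1 m n N))"

definition Jann :: "nat \<Rightarrow> nat \<Rightarrow> nat \<Rightarrow> mat set" where
  "Jann m n N = {M \<in> Cmn m n N. \<forall>v\<in>V0 m n N. app m n N M v = vzero}"

definition two_sided_ideal :: "nat \<Rightarrow> nat \<Rightarrow> nat \<Rightarrow> mat set \<Rightarrow> mat set \<Rightarrow> bool" where
  "two_sided_ideal m n N S C \<longleftrightarrow> S \<subseteq> C \<and> mzero \<in> S \<and>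
     (\<forall>x\<in>S. \<forall>y\<in>S. madd x y \<in> S) \<and> (\<forall>c. \<forall>x\<in>S. msmul c x \<in> S) \<and>
     (\<forall>x\<in>S. \<forall>y\<in>C. mmul m n N x y \<in> S \<and> mmul m n N y x \<in> S)"

definition coset :: "mat set \<Rightarrow> mat \<Rightarrow> mat set" where
  "coset J x = {madd x j | j. j \<in> J}"

definition quot :: "mat set \<Rightarrow> mat set \<Rightarrow> mat set set" where
  "quot C J = {coset J x | x. x \<in> C}"

end

theory Submission
  imports Defs "HOL-Combinatorics.Permutations" "Jordan_Normal_Form.Char_Poly"
begin

text \<open>
  The subspaces \<open>V\<^sub>0\<close> and \<open>V\<^sub>1\<close> are orthogonal complements for the standard Hermitian form, as
  contraction and insertion are adjoint; so the projector \<open>P\<close> exists and commutes with every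
  operator that, together with its adjoint, preserves \<open>V\<^sub>0\<close>. The group acts by such operators, hence
  \<open>P\<close> lies in the centraliser algebra. Conversely, the partial transpose of an element of the
  centraliser algebra commutes with \<open>g \<otimes> \<dots> \<otimes> g\<close> for all \<open>g\<close>, hence is a combination of
  permutation operators by Schur--Weyl duality. Undoing the transpose, each permutation becomes a
  walled Brauer diagram, which either contracts its argument (and so kills \<open>V\<^sub>0\<close>) or permutes the
  factors of each kind (and so preserves \<open>V\<^sub>0\<close>). Therefore \<open>P\<close> is a central idempotent with
  annihilator \<open>J\<close>, from which the splitting is formal.
\<close>

text \<open>Lying in the centraliser algebra makes \<open>P\<close> commute with the group only.
  Centrality in the algebra needs a description of all its elements, and this is the one use of
  Schur--Weyl duality. Two obstacles shape that part. Permutation operators are isolated by testing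
  against sums of matrix units, which may be singular, so commutation must first be extended from
  invertible matrices to all matrices. And complete reducibility is replaced throughout by positive
  definiteness of the Hermitian form: it gives both the decomposition into \<open>V0\<close> and
  \<open>V1\<close> and the double commutant step. Adjoints halve the remaining work. Both families
  of operators are closed under them (a group element goes to its conjugate transpose, a diagram to
  its reflection), so only preservation of \<open>V0\<close> is ever checked by computation, and
  preservation of \<open>V1\<close> follows by duality.\<close>

section \<open>The general linear group\<close>

lemma GL_iff_mat_mult:
  "(g, h) \<in> GL N \<longleftrightarrow>
    Matrix.mat N N (\<lambda>(i,j). g i j) * Matrix.mat N N (\<lambda>(i,j). h i j) = 1\<^sub>m N"
proof -
  have "(Matrix.mat N N (\<lambda>(i,j). g i j) * Matrix.mat N N (\<lambda>(i,j). h i j)) $$ (i, j)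
      = (\<Sum>k<N. g i k * h k j)" if "i < N" "j < N" for i j
    using that by (simp add: scalar_prod_def atLeast0LessThan)
  then show ?thesis
    by (auto simp: GL_def Matrix.mat_eq_iff)
qed

text \<open>\<open>GL\<close> records only \<open>g h = 1\<close>; for square matrices a right
  inverse is also a left inverse.\<close>

lemma GL_swap:
  assumes "(g, h) \<in> GL N"
  shows "(h, g) \<in> GL N"
  unfolding GL_iff_mat_mult
  by (rule mat_mult_left_right_inverse[OF _ _ assms[unfolded GL_iff_mat_mult]]) auto

text \<open>Up to sign, the determinant of \<open>t + g\<close> is the characteristic polynomial of
  \<open>- g\<close> at \<open>t\<close>, a monic polynomial with finitely many roots.\<close>

lemma finite_not_GL_shift:
  "finite {t. \<not> (\<exists>h. (\<lambda>i j. (if i = j then t else 0) + g i j, h) \<in> GL N)}"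
proof -
  define A where "A = Matrix.mat N N (\<lambda>(i,j). - g i j)"
  have A: "A \<in> carrier_mat N N" by (simp add: A_def)
  have nz: "char_poly A \<noteq> 0"
    using degree_monic_char_poly[OF A] by auto
  have "\<exists>h. (\<lambda>i j. (if i = j then t else 0) + g i j, h) \<in> GL N"
    if "poly (char_poly A) t \<noteq> 0" for t
  proof -
    define S where "S = Matrix.mat N N (\<lambda>(i,j). (if i = j then t else 0) + g i j)"
    have S: "S \<in> carrier_mat N N" by (simp add: S_def)
    have "det (char_matrix A t) \<noteq> 0"
      using that eigenvalue_det[OF A] eigenvalue_root_char_poly[OF A] by metis
    moreover have "S = (-1) \<cdot>\<^sub>m char_matrix A t"
      by (rule eq_matI) (auto simp: S_def A_def char_matrix_def)
    ultimately have "det S \<noteq> 0"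
      using A by (simp add: char_matrix_def)
    from det_non_zero_imp_unit[OF S this, unfolded Units_def, of "()"]
    obtain B where B: "B \<in> carrier_mat N N" "S * B = 1\<^sub>m N"
      by (auto simp: ring_mat_def)
    have "B = Matrix.mat N N (\<lambda>(i,j). B $$ (i, j))"
      using B(1) by auto
    then have "(\<lambda>i j. (if i = j then t else 0) + g i j, \<lambda>i j. B $$ (i, j)) \<in> GL N"
      using B(2) unfolding GL_iff_mat_mult S_def by metis
    then show ?thesis by blast
  qed
  then have "{t. \<not> (\<exists>h. (\<lambda>i j. (if i = j then t else 0) + g i j, h) \<in> GL N)}
      \<subseteq> {t. poly (char_poly A) t = 0}"
    by blast
  then show ?thesis
    using poly_roots_finite[OF nz] finite_subset by blast
qed

section \<open>Tensor powers of matrices\<close>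

definition tuples :: "nat \<Rightarrow> nat \<Rightarrow> nat list set" where
  "tuples k N = {xs. length xs = k \<and> set xs \<subseteq> {..<N}}"

lemma idxs_eq: "idxs m n N = tuples m N \<times> tuples n N"
  by (auto simp: idxs_def tuples_def)

lemma finite_tuples [simp]: "finite (tuples k N)"
  using finite_lists_length_eq[of "{..<N}" k] by (simp add: tuples_def conj_commute)

lemma finite_idxs [simp]: "finite (idxs m n N)"
  by (simp add: idxs_eq)

lemma length_tuples: "u \<in> tuples k N \<Longrightarrow> length u = k"
  by (simp add: tuples_def)

lemma nth_tuples: "u \<in> tuples k N \<Longrightarrow> p < k \<Longrightarrow> u ! p < N"
  by (auto simp: tuples_def subset_iff)

lemma tuples_eq_iff:
  "u \<in> tuples k N \<Longrightarrow> w \<in> tuples k N \<Longrightarrow> u = w \<longleftrightarrow> (\<forall>p<k. u ! p = w ! p)"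
  by (auto simp: tuples_def list_eq_iff_nth_eq)

lemma permute_list_tuples:
  "\<sigma> permutes {..<k} \<Longrightarrow> u \<in> tuples k N \<Longrightarrow> permute_list \<sigma> u \<in> tuples k N"
  by (simp add: tuples_def)

lemma list_update_tuples: "u \<in> tuples k N \<Longrightarrow> t < N \<Longrightarrow> u[p := t] \<in> tuples k N"
  using set_update_subset_insert[of u p t] by (auto simp: tuples_def)

lemma tuples_Suc: "tuples (Suc k) N = (\<lambda>(i, w). i # w) ` ({..<N} \<times> tuples k N)"
proof (intro equalityI subsetI)
  fix u assume "u \<in> tuples (Suc k) N"
  then show "u \<in> (\<lambda>(i, w). i # w) ` ({..<N} \<times> tuples k N)"
    by (cases u) (auto simp: tuples_def)
qed (auto simp: tuples_def)

lemma sum_tuples_prod: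
  fixes f :: "nat \<Rightarrow> nat \<Rightarrow> 'a :: comm_semiring_1"
  shows "(\<Sum>w\<in>tuples k N. \<Prod>p<k. f p (w ! p)) = (\<Prod>p<k. \<Sum>i<N. f p i)"
proof (induction k arbitrary: f)
  case 0
  have "tuples 0 N = {[]}" by (auto simp: tuples_def)
  then show ?case by simp
next
  case (Suc k)
  have inj: "inj_on (\<lambda>(i, w). i # w) ({..<N} \<times> tuples k N)"
    by (auto simp: inj_on_def)
  have "(\<Sum>w\<in>tuples (Suc k) N. \<Prod>p<Suc k. f p (w ! p))
      = (\<Sum>(i, w)\<in>{..<N} \<times> tuples k N. f 0 i * (\<Prod>p<k. f (Suc p) (w ! p)))"
    unfolding tuples_Suc sum.reindex[OF inj]
    by (intro sum.cong) (auto simp: prod.lessThan_Suc_shift simp del: prod.lessThan_Suc)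
  also have "\<dots> = (\<Sum>i<N. f 0 i) * (\<Sum>w\<in>tuples k N. \<Prod>p<k. f (Suc p) (w ! p))"
    by (simp add: sum_product sum.cartesian_product)
  finally show ?case
    by (simp add: Suc.IH[of "\<lambda>p. f (Suc p)"] prod.lessThan_Suc_shift del: prod.lessThan_Suc)
qed

text \<open>Matrix entry of the \<open>k\<close>-th tensor power of \<open>g\<close>. The entries
  range over a general semiring because the density argument below needs polynomial entries.\<close>

definition tpow :: "nat \<Rightarrow> (nat \<Rightarrow> nat \<Rightarrow> 'a) \<Rightarrow> nat list \<Rightarrow> nat list \<Rightarrow> 'a :: comm_semiring_1" where
  "tpow k g u w = (\<Prod>p<k. g (u ! p) (w ! p))"

lemma prod_of_bool:
  "finite A \<Longrightarrow> (\<Prod>p\<in>A. of_bool (P p)) = (of_bool (\<forall>p\<in>A. P p) :: 'a :: comm_semiring_1)"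
  by (induction A rule: finite_induct) auto

lemma tpow_inverse:
  assumes "(g, h) \<in> GL N" "u \<in> tuples k N" "z \<in> tuples k N"
  shows "(\<Sum>w\<in>tuples k N. tpow k g u w * tpow k h w z) = of_bool (u = z)"
proof -
  have "(\<Sum>w\<in>tuples k N. tpow k g u w * tpow k h w z)
      = (\<Prod>p<k. \<Sum>i<N. g (u ! p) i * h i (z ! p))"
    unfolding tpow_def prod.distrib[symmetric]
    by (rule sum_tuples_prod[of "\<lambda>p i. g (u ! p) i * h i (z ! p)"])
  also have "\<dots> = (\<Prod>p<k. of_bool (u ! p = z ! p))"
    using assms by (intro prod.cong) (auto simp: GL_def nth_tuples of_bool_def)
  also have "\<dots> = of_bool (u = z)"
    using tuples_eq_iff[OF assms(2,3)] by (simp add: prod_of_bool Ball_def)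
  finally show ?thesis .
qed

lemma tpow_append:
  assumes "length a = m" "length c = m"
  shows "tpow (m + n) g (a @ b) (c @ d) = tpow m g a c * tpow n g b d"
proof -
  have "tpow (m + n) g (a @ b) (c @ d)
      = (\<Prod>p\<in>{..<m} \<union> {m..<m+n}. g ((a @ b) ! p) ((c @ d) ! p))"
    unfolding tpow_def by (intro prod.cong) auto
  also have "\<dots> = (\<Prod>p<m. g ((a @ b) ! p) ((c @ d) ! p))
      * (\<Prod>p\<in>{m..<m+n}. g ((a @ b) ! p) ((c @ d) ! p))"
    by (intro prod.union_disjoint) auto
  also have "(\<Prod>p\<in>{m..<m+n}. g ((a @ b) ! p) ((c @ d) ! p)) = tpow n g b d"
    unfolding tpow_def using assms
    by (intro prod.reindex_bij_witness[of _ "\<lambda>p. p + m" "\<lambda>p. p - m"]) (auto simp: nth_append)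
  also have "(\<Prod>p<m. g ((a @ b) ! p) ((c @ d) ! p)) = tpow m g a c"
    unfolding tpow_def using assms by (intro prod.cong) (auto simp: nth_append)
  finally show ?thesis .
qed

section \<open>Schur--Weyl duality\<close>

definition tcomm :: "nat \<Rightarrow> nat \<Rightarrow> (nat list \<Rightarrow> nat list \<Rightarrow> complex) \<Rightarrow> (nat \<Rightarrow> nat \<Rightarrow> complex) \<Rightarrow> bool" where
  "tcomm k N T g \<longleftrightarrow> (\<forall>u\<in>tuples k N. \<forall>z\<in>tuples k N.
     (\<Sum>w\<in>tuples k N. T u w * tpow k g w z) = (\<Sum>w\<in>tuples k N. tpow k g u w * T w z))"

text \<open>For fixed \<open>g\<close> the commutator of \<open>T\<close> with the tensor power of \<open>t + g\<close> is a polynomial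
  in \<open>t\<close>, so the finitely many \<open>t\<close> for which \<open>t + g\<close> is singular do not matter.\<close>

lemma tcomm_all_if_tcomm_GL:
  assumes "\<And>g h. (g, h) \<in> GL N \<Longrightarrow> tcomm k N T g"
  shows "tcomm k N T g"
  unfolding tcomm_def
proof (intro ballI)
  fix u z assume uz: "u \<in> tuples k N" "z \<in> tuples k N"
  \<comment> \<open>The matrix \<open>g + t\<close> with \<open>t\<close> as polynomial variable;
    \<open>Q\<close> is then an entry of the commutator.\<close>
  define G where "G i j = [:g i j, if i = j then 1 else 0:]" for i j
  define Q where "Q = (\<Sum>w\<in>tuples k N. [:T u w:] * tpow k G w z)
      - (\<Sum>w\<in>tuples k N. tpow k G u w * [:T w z:])"
  have Gt: "poly (tpow k G x y) t = tpow k (\<lambda>i j. (if i = j then t else 0) + g i j) x y" for x y t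
    unfolding tpow_def poly_prod G_def by (intro prod.cong) auto
  have Q: "poly Q t = (\<Sum>w\<in>tuples k N. T u w * tpow k (\<lambda>i j. (if i = j then t else 0) + g i j) w z)
      - (\<Sum>w\<in>tuples k N. tpow k (\<lambda>i j. (if i = j then t else 0) + g i j) u w * T w z)" for t
    by (simp add: Q_def poly_sum Gt mult.commute)
  have "- {t. poly Q t = 0} \<subseteq> {t. \<not> (\<exists>h. (\<lambda>i j. (if i = j then t else 0) + g i j, h) \<in> GL N)}"
    using assms uz unfolding Q tcomm_def by fastforce
  then have "finite (- {t. poly Q t = 0})"
    using finite_not_GL_shift finite_subset by blast
  then have "infinite {t. poly Q t = 0}"
    using infinite_UNIV_char_0[where 'a = complex] by (metis finite_compl)
  then have "Q = 0"
    using poly_roots_finite by blast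
  \<comment> \<open>At \<open>t = 0\<close> the shifted matrix is \<open>g\<close> itself.\<close>
  then have "poly Q 0 = 0" by simp
  then show "(\<Sum>w\<in>tuples k N. T u w * tpow k g w z) = (\<Sum>w\<in>tuples k N. tpow k g u w * T w z)"
    unfolding Q by simp
qed

text \<open>Expand the product over \<open>A\<close> of the factors
  \<open>-1 + of_bool (s \<notin> B)\<close>, with \<open>S\<close> the set of places where
  \<open>-1\<close> is chosen. Each factor vanishes off \<open>B\<close>, so the product survives
  only for \<open>B = A\<close>.\<close>

lemma sum_Pow_superset_alternating:
  assumes "finite A" "B \<subseteq> A"
  shows "(\<Sum>S\<in>Pow A. (-1) ^ card S * of_bool (B \<subseteq> S)) = ((-1) ^ card A * of_bool (B = A) :: 'a :: comm_ring_1)"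
proof -
  have "(\<Sum>S\<in>Pow A. (-1) ^ card S * of_bool (B \<subseteq> S))
      = (\<Sum>S\<in>Pow A. (\<Prod>s\<in>S. -1) * (\<Prod>s\<in>A - S. of_bool (s \<notin> B)) :: 'a)"
  proof (intro sum.cong refl)
    fix S assume "S \<in> Pow A"
    then have "B \<subseteq> S \<longleftrightarrow> (\<forall>s\<in>A - S. s \<notin> B)" using assms by auto
    then show "(-1) ^ card S * of_bool (B \<subseteq> S) = (\<Prod>s\<in>S. -1) * (\<Prod>s\<in>A - S. of_bool (s \<notin> B) :: 'a)"
      using assms by (simp add: prod_of_bool)
  qed
  also have "\<dots> = (\<Prod>s\<in>A. -1 + of_bool (s \<notin> B))"
    by (rule prod_add[OF assms(1), symmetric])
  also have "\<dots> = (\<Prod>s\<in>A. (-1) * of_bool (s \<in> B))"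
    by (intro prod.cong) auto
  also have "\<dots> = (-1) ^ card A * of_bool (\<forall>s\<in>A. s \<in> B)"
    using assms by (subst prod.distrib) (simp add: prod_of_bool)
  also have "(\<forall>s\<in>A. s \<in> B) \<longleftrightarrow> B = A" using assms by auto
  finally show ?thesis .
qed

text \<open>The sum over \<open>S\<close> of the matrix units with row \<open>a ! s\<close> and
  column \<open>b ! s\<close>. It may be singular, hence the extension of commutation beyond
  \<open>GL\<close>.\<close>

definition punit :: "nat list \<Rightarrow> nat list \<Rightarrow> nat set \<Rightarrow> nat \<Rightarrow> nat \<Rightarrow> complex" where
  "punit a b S i j = (\<Sum>s\<in>S. of_bool (i = a ! s \<and> j = b ! s))"

text \<open>Polarisation: inclusion--exclusion over \<open>S\<close> isolates the surjective maps in the expansion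
  of the tensor power of a sum of matrix units.\<close>

lemma polarization:
  assumes "u \<in> tuples k N" "w \<in> tuples k N" "a \<in> tuples k N" "b \<in> tuples k N"
  shows "(\<Sum>S\<in>Pow {..<k}. (-1) ^ card S * tpow k (punit a b S) u w)
    = (-1) ^ k * (\<Sum>\<sigma> | \<sigma> permutes {..<k}. of_bool (u = permute_list \<sigma> a \<and> w = permute_list \<sigma> b))"
proof -
  define F where "F = {..<k} \<rightarrow>\<^sub>E {..<k}"
  define c where "c f = (of_bool (\<forall>p<k. u ! p = a ! f p \<and> w ! p = b ! f p) :: complex)" for f :: "nat \<Rightarrow> nat"
  \<comment> \<open>Multiplying out the product of sums: \<open>f p\<close> is the matrix unit
    chosen in the tensor factor \<open>p\<close>.\<close>
  have expand: "tpow k (punit a b S) u w = (\<Sum>f\<in>F. c f * of_bool (f ` {..<k} \<subseteq> S))"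
    if "S \<subseteq> {..<k}" for S
  proof -
    have "tpow k (punit a b S) u w
        = (\<Prod>p<k. \<Sum>s<k. of_bool (u ! p = a ! s \<and> w ! p = b ! s \<and> s \<in> S))"
      unfolding tpow_def punit_def
      by (intro prod.cong refl sum.mono_neutral_cong_left) (use that in auto)
    also have "\<dots> = (\<Sum>f\<in>F. \<Prod>p<k. of_bool (u ! p = a ! f p \<and> w ! p = b ! f p \<and> f p \<in> S))"
      unfolding F_def by (intro prod_sum_PiE) auto
    also have "\<dots> = (\<Sum>f\<in>F. c f * of_bool (f ` {..<k} \<subseteq> S))"
      unfolding c_def by (intro sum.cong) (auto simp: prod_of_bool)
    finally show ?thesis .
  qed
  have "(\<Sum>S\<in>Pow {..<k}. (-1) ^ card S * tpow k (punit a b S) u w)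
      = (\<Sum>S\<in>Pow {..<k}. \<Sum>f\<in>F. c f * ((-1) ^ card S * of_bool (f ` {..<k} \<subseteq> S)))"
    by (intro sum.cong refl) (simp add: expand sum_distrib_left mult_ac)
  also have "\<dots> = (\<Sum>f\<in>F. c f * (\<Sum>S\<in>Pow {..<k}. (-1) ^ card S * of_bool (f ` {..<k} \<subseteq> S)))"
    unfolding sum_distrib_left by (rule sum.swap)
  also have "\<dots> = (\<Sum>f\<in>F. c f * ((-1) ^ k * of_bool (f ` {..<k} = {..<k})))"
    by (intro sum.cong refl, subst sum_Pow_superset_alternating) (auto simp: F_def)
  also have "\<dots> = (-1) ^ k * (\<Sum>f\<in>F. c f * of_bool (f ` {..<k} = {..<k}))"
    by (simp add: sum_distrib_left mult_ac)
  also have "(\<Sum>f\<in>F. c f * of_bool (f ` {..<k} = {..<k}))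
      = (\<Sum>f | f \<in> F \<and> f ` {..<k} = {..<k}. c f)"
    by (rule sum.mono_neutral_cong_right) (auto simp: F_def finite_PiE)
  also have "\<dots> = (\<Sum>\<sigma> | \<sigma> permutes {..<k}. of_bool (u = permute_list \<sigma> a \<and> w = permute_list \<sigma> b))"
  \<comment> \<open>Surjective self-maps of a finite set are its permutations; the two conversions
    only reconcile \<open>undefined\<close> outside \<open>{..<k}\<close> with the identity
    there.\<close>
  proof (rule sum.reindex_bij_witness[of _ "\<lambda>\<sigma>. restrict \<sigma> {..<k}" "\<lambda>f x. if x < k then f x else x"])
    fix f assume f: "f \<in> {f \<in> F. f ` {..<k} = {..<k}}"
    define \<sigma> where "\<sigma> = (\<lambda>x. if x < k then f x else x)"
    have im: "\<sigma> ` {..<k} = {..<k}" using f by (auto simp: \<sigma>_def)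
    then have "inj_on \<sigma> {..<k}" by (simp add: eq_card_imp_inj_on)
    then have \<sigma>: "\<sigma> permutes {..<k}"
      using im by (intro bij_imp_permutes) (auto simp: bij_betw_def \<sigma>_def)
    then show "(\<lambda>x. if x < k then f x else x) \<in> {\<sigma>. \<sigma> permutes {..<k}}" by (simp add: \<sigma>_def)
    have "f \<in> extensional {..<k}" using f by (simp add: F_def PiE_iff)
    then show "restrict (\<lambda>x. if x < k then f x else x) {..<k} = f"
      by (auto simp: fun_eq_iff restrict_def extensional_def)
    have "u = permute_list \<sigma> a \<and> w = permute_list \<sigma> b
        \<longleftrightarrow> (\<forall>p<k. u ! p = a ! f p \<and> w ! p = b ! f p)"
      using assms \<sigma>
      by (simp add: tuples_eq_iff[OF assms(1) permute_list_tuples[OF \<sigma> assms(3)]]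
          tuples_eq_iff[OF assms(2) permute_list_tuples[OF \<sigma> assms(4)]]
          permute_list_nth length_tuples) (auto simp: \<sigma>_def)
    then show "of_bool (u = permute_list (\<lambda>x. if x < k then f x else x) a
        \<and> w = permute_list (\<lambda>x. if x < k then f x else x) b) = c f"
      by (simp add: c_def \<sigma>_def)
  next
    fix \<sigma> assume "\<sigma> \<in> {\<sigma>. \<sigma> permutes {..<k}}"
    then have \<sigma>: "\<sigma> permutes {..<k}" by simp
    then show "(\<lambda>x. if x < k then restrict \<sigma> {..<k} x else x) = \<sigma>"
      by (auto simp: fun_eq_iff permutes_def)
    show "restrict \<sigma> {..<k} \<in> {f \<in> F. f ` {..<k} = {..<k}}"
      using permutes_image[OF \<sigma>] by (auto simp: F_def)
  qed
  finally show ?thesis .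
qed

text \<open>This says that \<open>T\<close> commutes with the symmetrised matrix unit attached to
  \<open>(a, b)\<close>: by \<open>polarization\<close> that operator is a combination of tensor
  powers, and \<open>T\<close> commutes with each of these.\<close>

lemma sum_perm_commute:
  assumes T: "\<And>g. tcomm k N T g"
    and uz: "u \<in> tuples k N" "z \<in> tuples k N" and ab: "a \<in> tuples k N" "b \<in> tuples k N"
  shows "(\<Sum>\<sigma> | \<sigma> permutes {..<k}. T u (permute_list \<sigma> a) * of_bool (z = permute_list \<sigma> b))
    = (\<Sum>\<sigma> | \<sigma> permutes {..<k}. of_bool (u = permute_list \<sigma> a) * T (permute_list \<sigma> b) z)"
proof -
  let ?S = "\<lambda>u w. \<Sum>\<sigma> | \<sigma> permutes {..<k}. of_bool (u = permute_list \<sigma> a \<and> w = permute_list \<sigma> b) :: complex"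
  have "(\<Sum>S\<in>Pow {..<k}. (-1) ^ card S * (\<Sum>w\<in>tuples k N. T u w * tpow k (punit a b S) w z))
      = (\<Sum>S\<in>Pow {..<k}. (-1) ^ card S * (\<Sum>w\<in>tuples k N. tpow k (punit a b S) u w * T w z))"
    using T uz by (simp add: tcomm_def)
  also have "(\<Sum>S\<in>Pow {..<k}. (-1) ^ card S * (\<Sum>w\<in>tuples k N. T u w * tpow k (punit a b S) w z))
      = (\<Sum>w\<in>tuples k N. T u w * (\<Sum>S\<in>Pow {..<k}. (-1) ^ card S * tpow k (punit a b S) w z))"
    unfolding sum_distrib_left by (subst sum.swap) (simp add: mult_ac)
  also have "\<dots> = (\<Sum>w\<in>tuples k N. T u w * ((-1) ^ k * ?S w z))"
    using uz ab by (intro sum.cong refl) (simp add: polarization)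
  also have "\<dots> = (-1) ^ k * (\<Sum>w\<in>tuples k N. T u w * ?S w z)"
    by (simp add: sum_distrib_left mult_ac)
  also have "(\<Sum>S\<in>Pow {..<k}. (-1) ^ card S * (\<Sum>w\<in>tuples k N. tpow k (punit a b S) u w * T w z))
      = (\<Sum>w\<in>tuples k N. (\<Sum>S\<in>Pow {..<k}. (-1) ^ card S * tpow k (punit a b S) u w) * T w z)"
    unfolding sum_distrib_left sum_distrib_right by (subst sum.swap) (simp add: mult_ac)
  also have "\<dots> = (\<Sum>w\<in>tuples k N. ((-1) ^ k * ?S u w) * T w z)"
    using uz ab by (intro sum.cong refl) (simp add: polarization)
  also have "\<dots> = (-1) ^ k * (\<Sum>w\<in>tuples k N. ?S u w * T w z)"
    by (simp add: sum_distrib_left mult_ac)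
  finally have "(\<Sum>w\<in>tuples k N. T u w * ?S w z) = (\<Sum>w\<in>tuples k N. ?S u w * T w z)"
    by simp
  also have "(\<Sum>w\<in>tuples k N. T u w * ?S w z)
      = (\<Sum>\<sigma> | \<sigma> permutes {..<k}. \<Sum>w\<in>tuples k N.
          if w = permute_list \<sigma> a then T u w * of_bool (z = permute_list \<sigma> b) else 0)"
    unfolding sum_distrib_left by (subst sum.swap) (auto intro!: sum.cong)
  also have "\<dots> = (\<Sum>\<sigma> | \<sigma> permutes {..<k}. T u (permute_list \<sigma> a) * of_bool (z = permute_list \<sigma> b))"
    using ab by (intro sum.cong refl) (simp add: permute_list_tuples)
  also have "(\<Sum>w\<in>tuples k N. ?S u w * T w z)
      = (\<Sum>\<sigma> | \<sigma> permutes {..<k}. \<Sum>w\<in>tuples k N.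
          if w = permute_list \<sigma> b then of_bool (u = permute_list \<sigma> a) * T w z else 0)"
    unfolding sum_distrib_right by (subst sum.swap) (auto intro!: sum.cong)
  also have "\<dots> = (\<Sum>\<sigma> | \<sigma> permutes {..<k}. of_bool (u = permute_list \<sigma> a) * T (permute_list \<sigma> b) z)"
    using ab by (intro sum.cong refl) (simp add: permute_list_tuples)
  finally show ?thesis .
qed

section \<open>Orthogonal projection onto the span of a finite family\<close>

definition hinner :: "'i set \<Rightarrow> ('i \<Rightarrow> complex) \<Rightarrow> ('i \<Rightarrow> complex) \<Rightarrow> complex" where
  "hinner I f g = (\<Sum>x\<in>I. cnj (f x) * g x)"

lemma hinner_diff_right: "hinner I f (\<lambda>x. g x - h x) = hinner I f g - hinner I f h"
  by (simp add: hinner_def algebra_simps sum_subtractf)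

lemma hinner_scale_right: "hinner I f (\<lambda>x. c * g x) = c * hinner I f g"
  by (simp add: hinner_def sum_distrib_left mult_ac)

lemma hinner_sum_right: "hinner I f (\<lambda>x. \<Sum>j\<in>K. g j x) = (\<Sum>j\<in>K. hinner I f (g j))"
  unfolding hinner_def sum_distrib_left by (rule sum.swap)

lemma hinner_cnj: "hinner I f g = cnj (hinner I g f)"
  by (simp add: hinner_def mult.commute)

lemma hinner_self_eq_0:
  assumes "finite I" "hinner I f f = 0" "x \<in> I"
  shows "f x = 0"
proof -
  have "hinner I f f = of_real (\<Sum>x\<in>I. (cmod (f x))\<^sup>2)"
    by (simp add: hinner_def complex_norm_square[unfolded of_real_power] mult.commute)
  then have "(\<Sum>x\<in>I. (cmod (f x))\<^sup>2) = 0"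
    using assms(2) by (metis of_real_eq_0_iff)
  then show ?thesis
    using assms by (simp add: sum_nonneg_eq_0_iff)
qed

text \<open>Gram--Schmidt by induction on the family, without assuming independence: the residual of
  \<open>v\<close> is corrected by a multiple of the residual \<open>s\<close> of the new
  vector.\<close>

lemma projection_coefficients_exist:
  fixes b :: "'k \<Rightarrow> 'i \<Rightarrow> complex"
  assumes "finite K" "finite I"
  shows "\<exists>c. \<forall>j\<in>K. hinner I (b j) (\<lambda>x. v x - (\<Sum>l\<in>K. c l * b l x)) = 0"
  using assms(1)
proof (induction K arbitrary: v rule: finite_induct)
  case empty
  then show ?case by simp
next
  case (insert k K)
  obtain c where c: "\<forall>j\<in>K. hinner I (b j) (\<lambda>x. v x - (\<Sum>l\<in>K. c l * b l x)) = 0"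
    using insert.IH by blast
  obtain d where d: "\<forall>j\<in>K. hinner I (b j) (\<lambda>x. b k x - (\<Sum>l\<in>K. d l * b l x)) = 0"
    using insert.IH by blast
  define r where "r x = v x - (\<Sum>l\<in>K. c l * b l x)" for x
  define s where "s x = b k x - (\<Sum>l\<in>K. d l * b l x)" for x
  \<comment> \<open>If the new vector depends on the old ones, the denominator is 0 and so is
    \<open>\<alpha>\<close>; then \<open>s\<close> vanishes on \<open>I\<close> and no correction is
    required.\<close>
  define \<alpha> where "\<alpha> = hinner I s r / hinner I s s"
  define q where "q x = r x - \<alpha> * s x" for x
  define c' where "c' l = (if l = k then \<alpha> else c l - \<alpha> * d l)" for l
  have q: "q x = v x - (\<Sum>l\<in>insert k K. c' l * b l x)" for x
  proof -
    have "(\<Sum>l\<in>K. c' l * b l x) = (\<Sum>l\<in>K. c l * b l x - \<alpha> * (d l * b l x))"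
      using insert.hyps by (intro sum.cong) (auto simp: c'_def algebra_simps)
    then show ?thesis
      using insert.hyps
      by (simp add: q_def r_def s_def c'_def sum_subtractf sum_distrib_left algebra_simps)
  qed
  have qK: "hinner I (b j) q = 0" if "j \<in> K" for j
    using c d that
    by (simp add: q_def[abs_def] r_def[abs_def] s_def[abs_def] hinner_diff_right hinner_scale_right)
  have sq: "hinner I s q = 0"
  proof (cases "hinner I s s = 0")
    case True
    then have "s x = 0" if "x \<in> I" for x
      using hinner_self_eq_0[OF assms(2)] that by blast
    then show ?thesis by (simp add: hinner_def)
  next
    case False
    then show ?thesis
      unfolding q_def hinner_diff_right hinner_scale_right by (simp add: \<alpha>_def)
  qed
  have "hinner I q s = hinner I q (b k) - (\<Sum>l\<in>K. d l * hinner I q (b l))"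
    unfolding s_def hinner_diff_right hinner_sum_right hinner_scale_right ..
  moreover have "hinner I q s = 0" "\<And>l. l \<in> K \<Longrightarrow> hinner I q (b l) = 0"
    using sq qK hinner_cnj[of I q] by simp_all
  ultimately have "hinner I q (b k) = 0" by simp
  then have "hinner I (b k) q = 0"
    using hinner_cnj[of I "b k"] by simp
  then have "\<forall>j\<in>insert k K. hinner I (b j) q = 0"
    using qK by simp
  then show ?case
    unfolding q[abs_def] by blast
qed

section \<open>Matrices commuting with the general linear group\<close>

text \<open>The double commutant argument: the component \<open>Y\<close> of \<open>T\<close> orthogonal to the permutation
  operators satisfies \<open>\<Sum>\<^sub>\<sigma> |\<langle>Y, \<sigma>T\<rangle>|\<^sup>2 = 0\<close>, because \<open>T\<close> commutes with the symmetrisation of the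
  rank-one operator attached to \<open>Y\<close>.\<close>

lemma schur_weyl:
  assumes T: "\<And>g. tcomm k N T g"
  obtains c where "\<And>u w. u \<in> tuples k N \<Longrightarrow> w \<in> tuples k N \<Longrightarrow>
    T u w = (\<Sum>\<sigma> | \<sigma> permutes {..<k}. c \<sigma> * of_bool (w = permute_list \<sigma> u))"
proof -
  define L where "L = tuples k N"
  define Sk where "Sk = {\<sigma>. \<sigma> permutes {..<k}}"
  define \<beta> where "\<beta> \<sigma> = (\<lambda>(u, w). of_bool (w = permute_list \<sigma> (u :: nat list)) :: complex)" for \<sigma>
  have fin: "finite L" "finite Sk" "finite (L \<times> L)"
    by (simp_all add: L_def Sk_def finite_permutations)
  have perm_in: "permute_list \<sigma> u \<in> L" if "\<sigma> \<in> Sk" "u \<in> L" for \<sigma> u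
    using that by (simp add: L_def Sk_def permute_list_tuples)
  obtain c where c: "\<forall>\<sigma>\<in>Sk. hinner (L \<times> L) (\<beta> \<sigma>) (\<lambda>x. (case x of (u, w) \<Rightarrow> T u w) - (\<Sum>\<tau>\<in>Sk. c \<tau> * \<beta> \<tau> x)) = 0"
    using projection_coefficients_exist[OF fin(2,3)] by blast
  define Y where "Y u w = T u w - (\<Sum>\<tau>\<in>Sk. c \<tau> * \<beta> \<tau> (u, w))" for u w
  have orth: "(\<Sum>u\<in>L. Y u (permute_list \<sigma> u)) = 0" if \<sigma>: "\<sigma> \<in> Sk" for \<sigma>
  proof -
    have "0 = hinner (L \<times> L) (\<beta> \<sigma>) (\<lambda>(u, w). Y u w)"
      using c \<sigma> by (simp add: Y_def case_prod_unfold)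
    also have "\<dots> = (\<Sum>u\<in>L. \<Sum>w\<in>L. if w = permute_list \<sigma> u then Y u w else 0)"
      unfolding hinner_def sum.cartesian_product by (intro sum.cong) (auto simp: \<beta>_def)
    also have "\<dots> = (\<Sum>u\<in>L. Y u (permute_list \<sigma> u))"
      using fin perm_in[OF \<sigma>] by (intro sum.cong) auto
    finally show ?thesis by simp
  qed
  \<comment> \<open>The inner product of \<open>Y\<close> with \<open>T\<close> whose rows are
    permuted by \<open>\<sigma>\<close>.\<close>
  define s where "s \<sigma> = (\<Sum>b\<in>L. \<Sum>z\<in>L. cnj (Y b z) * T (permute_list \<sigma> b) z)" for \<sigma>
  \<comment> \<open>Weighting the commutation relation for \<open>(a, b)\<close> by
    \<open>Y a y * cnj (Y b z)\<close> puts this expression on one side, and on the other the inner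
    products of \<open>Y\<close> with permutation operators, which vanish by
    \<open>orth\<close>.\<close>
  have R: "(\<Sum>\<sigma>\<in>Sk. \<Sum>a\<in>L. of_bool (u = permute_list \<sigma> a) * Y a y * s \<sigma>) = 0"
    if u: "u \<in> L" for u y
  proof -
    have "(\<Sum>\<sigma>\<in>Sk. \<Sum>a\<in>L. of_bool (u = permute_list \<sigma> a) * Y a y * s \<sigma>)
        = (\<Sum>\<sigma>\<in>Sk. \<Sum>a\<in>L. \<Sum>b\<in>L. \<Sum>z\<in>L.
            Y a y * cnj (Y b z) * (of_bool (u = permute_list \<sigma> a) * T (permute_list \<sigma> b) z))"
      by (simp add: s_def sum_distrib_left mult_ac)
    also have "\<dots> = (\<Sum>a\<in>L. \<Sum>b\<in>L. \<Sum>z\<in>L. Y a y * cnj (Y b z) *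
            (\<Sum>\<sigma>\<in>Sk. of_bool (u = permute_list \<sigma> a) * T (permute_list \<sigma> b) z))"
      by (simp only: sum.swap[of _ _ Sk] sum_distrib_left)
    also have "\<dots> = (\<Sum>a\<in>L. \<Sum>b\<in>L. \<Sum>z\<in>L. Y a y * cnj (Y b z) *
            (\<Sum>\<sigma>\<in>Sk. T u (permute_list \<sigma> a) * of_bool (z = permute_list \<sigma> b)))"
      using u unfolding L_def Sk_def
      by (intro sum.cong refl arg_cong2[where f = "(*)"] sum_perm_commute[OF T, symmetric])
    also have "\<dots> = (\<Sum>a\<in>L. \<Sum>\<sigma>\<in>Sk. \<Sum>b\<in>L. \<Sum>z\<in>L.
            Y a y * cnj (Y b z) * (T u (permute_list \<sigma> a) * of_bool (z = permute_list \<sigma> b)))"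
      by (simp only: sum.swap[of _ Sk] sum_distrib_left)
    also have "\<dots> = (\<Sum>a\<in>L. \<Sum>\<sigma>\<in>Sk. Y a y * T u (permute_list \<sigma> a) * cnj (\<Sum>b\<in>L. Y b (permute_list \<sigma> b)))"
    proof (intro sum.cong refl)
      fix a \<sigma> assume \<sigma>: "\<sigma> \<in> Sk"
      have "(\<Sum>b\<in>L. \<Sum>z\<in>L. Y a y * cnj (Y b z) * (T u (permute_list \<sigma> a) * of_bool (z = permute_list \<sigma> b)))
          = (\<Sum>b\<in>L. \<Sum>z\<in>L. if z = permute_list \<sigma> b then Y a y * T u (permute_list \<sigma> a) * cnj (Y b z) else 0)"
        by (intro sum.cong) auto
      also have "\<dots> = (\<Sum>b\<in>L. Y a y * T u (permute_list \<sigma> a) * cnj (Y b (permute_list \<sigma> b)))"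
        using fin perm_in[OF \<sigma>] by (intro sum.cong) auto
      finally show "(\<Sum>b\<in>L. \<Sum>z\<in>L. Y a y * cnj (Y b z) * (T u (permute_list \<sigma> a) * of_bool (z = permute_list \<sigma> b)))
          = Y a y * T u (permute_list \<sigma> a) * cnj (\<Sum>b\<in>L. Y b (permute_list \<sigma> b))"
        by (simp add: sum_distrib_left)
    qed
    also have "\<dots> = 0"
      using orth by simp
    finally show ?thesis .
  qed
  \<comment> \<open>Pairing with \<open>T\<close> reproduces the conjugate of
    \<open>s \<sigma>\<close>, so the sum becomes the squared norm of \<open>s\<close>.\<close>
  have "0 = (\<Sum>u\<in>L. \<Sum>y\<in>L. cnj (T u y) * (\<Sum>\<sigma>\<in>Sk. \<Sum>a\<in>L. of_bool (u = permute_list \<sigma> a) * Y a y * s \<sigma>))"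
    using R by simp
  also have "\<dots> = (\<Sum>u\<in>L. \<Sum>y\<in>L. \<Sum>\<sigma>\<in>Sk. \<Sum>a\<in>L.
      if u = permute_list \<sigma> a then cnj (T u y) * Y a y * s \<sigma> else 0)"
    unfolding sum_distrib_left by (intro sum.cong) auto
  also have "\<dots> = (\<Sum>\<sigma>\<in>Sk. \<Sum>a\<in>L. \<Sum>y\<in>L. \<Sum>u\<in>L.
      if u = permute_list \<sigma> a then cnj (T u y) * Y a y * s \<sigma> else 0)"
    apply (simp only: sum.swap[of _ Sk])
    apply (rule sum.cong[OF refl])
    apply (subst sum.swap)
    apply (subst (2) sum.swap)
    apply (rule sum.cong[OF refl])
    apply (rule sum.swap)
    done
  also have "\<dots> = (\<Sum>\<sigma>\<in>Sk. \<Sum>a\<in>L. \<Sum>y\<in>L. cnj (T (permute_list \<sigma> a) y) * Y a y * s \<sigma>)"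
    using fin perm_in by (intro sum.cong refl) auto
  also have "\<dots> = (\<Sum>\<sigma>\<in>Sk. cnj (s \<sigma>) * s \<sigma>)"
    by (simp add: s_def sum_distrib_right mult_ac)
  also have "\<dots> = hinner Sk s s"
    by (simp add: hinner_def)
  finally have "s id = 0"
    using hinner_self_eq_0[OF fin(2), of s id] by (simp add: Sk_def permutes_id)
  then have YT: "hinner (L \<times> L) (\<lambda>(u, w). Y u w) (\<lambda>(u, w). T u w) = 0"
    by (simp add: s_def hinner_def sum.cartesian_product case_prod_unfold)
  have "hinner (L \<times> L) (\<lambda>(u, w). Y u w) (\<beta> \<sigma>) = 0" if "\<sigma> \<in> Sk" for \<sigma>
    using c that hinner_cnj[of "L \<times> L" _ "\<beta> \<sigma>"] by (simp add: Y_def case_prod_unfold)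
  \<comment> \<open>\<open>Y\<close> is orthogonal to \<open>T\<close> (the case
    \<open>\<sigma> = id\<close>) and to all permutation operators, hence to their combination
    \<open>Y\<close> itself.\<close>
  moreover have "hinner (L \<times> L) (\<lambda>(u, w). Y u w) (\<lambda>(u, w). Y u w)
      = hinner (L \<times> L) (\<lambda>(u, w). Y u w) (\<lambda>(u, w). T u w)
        - (\<Sum>\<sigma>\<in>Sk. c \<sigma> * hinner (L \<times> L) (\<lambda>(u, w). Y u w) (\<beta> \<sigma>))"
    unfolding hinner_scale_right[symmetric] hinner_sum_right[symmetric] hinner_diff_right[symmetric]
    by (simp add: Y_def case_prod_unfold)
  ultimately have YY: "hinner (L \<times> L) (\<lambda>(u, w). Y u w) (\<lambda>(u, w). Y u w) = 0"
    using YT by simp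
  have "T u w = (\<Sum>\<sigma>\<in>Sk. c \<sigma> * of_bool (w = permute_list \<sigma> u))" if "u \<in> L" "w \<in> L" for u w
    using hinner_self_eq_0[OF fin(3) YY, of "(u, w)"] that by (simp add: Y_def \<beta>_def)
  then show thesis
    using that unfolding L_def Sk_def by blast
qed

section \<open>Partial transposition: from mixed tensors to the tensor power of order
  \<open>m + n\<close>\<close>

lemma append_tuples: "a \<in> tuples m N \<Longrightarrow> b \<in> tuples n N \<Longrightarrow> a @ b \<in> tuples (m + n) N"
  by (auto simp: tuples_def)

lemma take_tuples: "u \<in> tuples (m + n) N \<Longrightarrow> take m u \<in> tuples m N"
  by (auto simp: tuples_def dest: in_set_takeD)

lemma drop_tuples: "u \<in> tuples (m + n) N \<Longrightarrow> drop m u \<in> tuples n N"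
  by (auto simp: tuples_def dest: in_set_dropD)

lemma sum_tuples_append:
  "(\<Sum>u\<in>tuples (m + n) N. f u) = (\<Sum>a\<in>tuples m N. \<Sum>b\<in>tuples n N. f (a @ b))"
proof -
  have "(\<Sum>u\<in>tuples (m + n) N. f u) = (\<Sum>(a, b)\<in>tuples m N \<times> tuples n N. f (a @ b))"
    by (rule sum.reindex_bij_witness[of _ "\<lambda>(a, b). a @ b" "\<lambda>u. (take m u, drop m u)"])
      (auto simp: append_tuples take_tuples drop_tuples length_tuples)
  then show ?thesis by (simp add: sum.cartesian_product)
qed

lemma rho_tpow:
  "x \<in> idxs m n N \<Longrightarrow> y \<in> idxs m n N \<Longrightarrow>
    rho m n N g h x y = tpow m g (fst x) (fst y) * tpow n h (snd y) (snd x)"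
  by (cases x; cases y) (auto simp: rho_def tpow_def)

text \<open>Row and column of \<open>M\<close> exchange their dual indices, which turns an operator
  on mixed tensors into one on the tensor power of order \<open>m + n\<close> of V.\<close>

definition ptrans :: "nat \<Rightarrow> (idx \<Rightarrow> idx \<Rightarrow> complex) \<Rightarrow> nat list \<Rightarrow> nat list \<Rightarrow> complex" where
  "ptrans m M u w = M (take m u, drop m w) (take m w, drop m u)"

text \<open>Multiplying by \<open>g\<close> on the dual factors moves the contragredient action to the other side of
  the equation.\<close>

lemma tcomm_ptrans:
  assumes M: "M \<in> Cmn m n N" and gh: "(g, h) \<in> GL N"
  shows "tcomm (m + n) N (ptrans m M) g"
  unfolding tcomm_def
proof (intro ballI)
  fix u z assume uz: "u \<in> tuples (m + n) N" "z \<in> tuples (m + n) N"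
  define a where "a = take m u"
  define \<beta> where "\<beta> = drop m u"
  define a' where "a' = take m z"
  define \<gamma> where "\<gamma> = drop m z"
  define A where "A = tuples m N"
  define B where "B = tuples n N"
  have mem: "a \<in> A" "a' \<in> A" "\<beta> \<in> B" "\<gamma> \<in> B"
    using uz by (simp_all add: a_def a'_def \<beta>_def \<gamma>_def A_def B_def take_tuples drop_tuples)
  have u: "u = a @ \<beta>" and z: "z = a' @ \<gamma>"
    by (simp_all add: a_def a'_def \<beta>_def \<gamma>_def)
  have len: "length x = m" if "x \<in> A" for x
    using that by (simp add: A_def length_tuples)
  have fin: "finite A" "finite B" by (simp_all add: A_def B_def)
  have E: "(\<Sum>c\<in>A. \<Sum>d\<in>B. M (a, b) (c, d) * (tpow m g c a' * tpow n h b' d))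
      = (\<Sum>c\<in>A. \<Sum>d\<in>B. tpow m g a c * tpow n h d b * M (c, d) (a', b'))"
    if "b \<in> B" "b' \<in> B" for b b'
  proof -
    have "mmul m n N M (rho m n N g h) (a, b) (a', b') = mmul m n N (rho m n N g h) M (a, b) (a', b')"
      using M gh by (auto simp: Cmn_def)
    then show ?thesis
      using that mem
      by (simp add: mmul_def idxs_eq A_def B_def sum.cartesian_product' rho_tpow)
  qed
  have inv: "(\<Sum>b'\<in>B. tpow n g \<beta> b' * tpow n h b' d) = of_bool (\<beta> = d)"
      "(\<Sum>b\<in>B. tpow n h d b * tpow n g b \<gamma>) = of_bool (d = \<gamma>)" if "d \<in> B" for d
    using that mem tpow_inverse[OF gh] tpow_inverse[OF GL_swap[OF gh]] by (simp_all only: B_def)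
  have delta: "(\<Sum>d\<in>B. f d * of_bool (e = d)) = f e" "(\<Sum>d\<in>B. f d * of_bool (d = e)) = f e"
    if "e \<in> B" for e and f :: "nat list \<Rightarrow> complex"
    using fin that by (simp_all add: of_bool_def if_distrib cong: if_cong)
  have "(\<Sum>w\<in>tuples (m + n) N. ptrans m M u w * tpow (m + n) g w z)
      = (\<Sum>c\<in>A. \<Sum>b\<in>B. M (a, b) (c, \<beta>) * (tpow m g c a' * tpow n g b \<gamma>))"
    unfolding sum_tuples_append u z A_def[symmetric] B_def[symmetric] ptrans_def
    using mem by (intro sum.cong refl) (simp add: tpow_append len)
  \<comment> \<open>The dual column index \<open>\<beta>\<close> is freed by inserting
    \<open>g h = 1\<close>; this creates the factor \<open>h\<close> that the relation
    \<open>E\<close> expects. After \<open>E\<close> the factor \<open>h\<close> is on the other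
    side and cancels against \<open>tpow n g b \<gamma>\<close> by \<open>h g = 1\<close>.\<close>
  also have "\<dots> = (\<Sum>c\<in>A. \<Sum>b\<in>B. \<Sum>d\<in>B. M (a, b) (c, d) * tpow m g c a' * tpow n g b \<gamma>
      * (\<Sum>b'\<in>B. tpow n g \<beta> b' * tpow n h b' d))"
    using mem by (simp add: inv delta mult.assoc[symmetric] cong: sum.cong)
  also have "\<dots> = (\<Sum>c\<in>A. \<Sum>b\<in>B. \<Sum>d\<in>B. \<Sum>b'\<in>B. tpow n g \<beta> b' * tpow n g b \<gamma> *
       (M (a, b) (c, d) * (tpow m g c a' * tpow n h b' d)))"
    by (simp add: sum_distrib_left mult_ac)
  also have "\<dots> = (\<Sum>b\<in>B. \<Sum>b'\<in>B. tpow n g \<beta> b' * tpow n g b \<gamma> *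
       (\<Sum>c\<in>A. \<Sum>d\<in>B. M (a, b) (c, d) * (tpow m g c a' * tpow n h b' d)))"
    unfolding sum_distrib_left
    apply (subst sum.swap)
    apply (subst (3) sum.swap)
    apply (subst (2) sum.swap)
    apply (rule refl)
    done
  also have "\<dots> = (\<Sum>b\<in>B. \<Sum>b'\<in>B. tpow n g \<beta> b' * tpow n g b \<gamma> *
       (\<Sum>c\<in>A. \<Sum>d\<in>B. tpow m g a c * tpow n h d b * M (c, d) (a', b')))"
    by (intro sum.cong refl) (simp add: E)
  also have "\<dots> = (\<Sum>c\<in>A. \<Sum>b'\<in>B. \<Sum>d\<in>B. \<Sum>b\<in>B. tpow n g \<beta> b' * tpow n g b \<gamma> *
       (tpow m g a c * tpow n h d b * M (c, d) (a', b')))"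
    unfolding sum_distrib_left
    apply (simp only: sum.swap[of _ A B])
    apply (rule sum.cong[OF refl])
    apply (rule trans[OF sum.swap])
    apply (rule sum.cong[OF refl])
    apply (rule sum.swap)
    done
  also have "\<dots> = (\<Sum>c\<in>A. \<Sum>b'\<in>B. \<Sum>d\<in>B. tpow n g \<beta> b' * tpow m g a c * M (c, d) (a', b')
      * (\<Sum>b\<in>B. tpow n h d b * tpow n g b \<gamma>))"
    by (simp add: sum_distrib_left mult_ac)
  also have "\<dots> = (\<Sum>c\<in>A. \<Sum>b'\<in>B. tpow n g \<beta> b' * tpow m g a c * M (c, \<gamma>) (a', b'))"
    using mem by (simp add: inv delta cong: sum.cong)
  also have "\<dots> = (\<Sum>w\<in>tuples (m + n) N. tpow (m + n) g u w * ptrans m M w z)"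
    unfolding sum_tuples_append u z A_def[symmetric] B_def[symmetric] ptrans_def
    using mem by (intro sum.cong refl) (simp add: tpow_append len)
  finally show "(\<Sum>w\<in>tuples (m + n) N. ptrans m M u w * tpow (m + n) g w z)
      = (\<Sum>w\<in>tuples (m + n) N. tpow (m + n) g u w * ptrans m M w z)" .
qed

section \<open>The traceless subspace\<close>

lemma ins_del: "p < length a \<Longrightarrow> ins p t (del p a) = a[p := t]"
  by (simp add: ins_def del_def upd_conv_take_nth_drop min_absorb2)

lemma ins_nth_del: "p < length a \<Longrightarrow> ins p (a ! p) (del p a) = a"
  by (simp add: ins_del)

lemma del_ins: "p \<le> length c \<Longrightarrow> del p (ins p t c) = c"
  by (simp add: ins_def del_def min_absorb2)

lemma nth_ins: "p \<le> length c \<Longrightarrow> ins p t c ! p = t"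
  by (simp add: ins_def nth_append)

lemma del_update: "del p (a[p := t]) = del p a"
  by (simp add: del_def)

lemma ins_update: "p \<le> length c \<Longrightarrow> (ins p s c)[p := t] = ins p t c"
  by (simp add: ins_def list_update_append)

lemma del_tuples: "a \<in> tuples m N \<Longrightarrow> p < m \<Longrightarrow> del p a \<in> tuples (m - 1) N"
  by (auto simp: tuples_def del_def dest: in_set_takeD in_set_dropD)

lemma ins_tuples: "c \<in> tuples (m - 1) N \<Longrightarrow> p < m \<Longrightarrow> t < N \<Longrightarrow> ins p t c \<in> tuples m N"
  by (auto simp: tuples_def ins_def dest: in_set_takeD in_set_dropD)

text \<open>Together with \<open>V0I\<close> this restates tracelessness by overwriting two entries
  of a full index, so that later arguments avoid \<open>ins\<close> and \<open>del\<close>.\<close>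

lemma V0_update:
  assumes "v \<in> V0 m n N" "p < m" "q < n" "(a, b) \<in> idxs m n N"
  shows "(\<Sum>t<N. v (a[p := t], b[q := t])) = 0"
proof -
  have "tr m n N p q v (del p a, del q b) = 0"
    using assms by (simp add: V0_def vzero_def)
  then show ?thesis
    using assms del_tuples[of a m N p] del_tuples[of b n N q]
    by (auto simp: tr_def idxs_eq ins_del length_tuples)
qed

lemma V0I:
  assumes v: "v \<in> vecs m n N"
    and contr: "\<And>p q a b. p < m \<Longrightarrow> q < n \<Longrightarrow> (a, b) \<in> idxs m n N \<Longrightarrow>
      (\<Sum>t<N. v (a[p := t], b[q := t])) = 0"
  shows "v \<in> V0 m n N"
proof -
  have "tr m n N p q v (c, d) = 0" if pq: "p < m" "q < n" for p q c d
  \<comment> \<open>The inserted value 0 is an arbitrary placeholder, overwritten by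
    \<open>t\<close>; it is a legal index only if \<open>N\<close> is positive, and otherwise the
    trace is an empty sum.\<close>
  proof (cases "(c, d) \<in> idxs (m - 1) (n - 1) N \<and> 0 < N")
    case True
    then have "(ins p 0 c, ins q 0 d) \<in> idxs m n N" "p \<le> length c" "q \<le> length d"
      using pq by (auto simp: idxs_eq ins_tuples length_tuples)
    then show ?thesis
      using contr[OF pq, of "ins p 0 c" "ins q 0 d"] True by (simp add: tr_def ins_update)
  next
    case False
    then show ?thesis by (auto simp: tr_def)
  qed
  then show ?thesis
    using v by (auto simp: V0_def vzero_def fun_eq_iff)
qed

text \<open>The involution exchanging the common value of the contracted pair of indices with a new
  summation index \<open>t\<close> turns \<open>N\<close> times the sum into a sum of traces of \<open>v\<close>.\<close>

lemma V0_contraction_sum: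
  assumes v: "v \<in> V0 m n N" and pq: "p < m" "q < n"
    and f: "\<And>a b t. (a, b) \<in> idxs m n N \<Longrightarrow> t < N \<Longrightarrow> a ! p = b ! q \<Longrightarrow>
      f (a[p := t], b[q := t]) = f (a, b)"
  shows "(\<Sum>x\<in>idxs m n N. of_bool (fst x ! p = snd x ! q) * f x * v x) = 0"
proof -
  define D where "D = {x \<in> idxs m n N. fst x ! p = snd x ! q}"
  define upd where "upd x t = ((fst x)[p := t], (snd x)[q := t])" for x :: idx and t
  have D: "(\<Sum>x\<in>idxs m n N. of_bool (fst x ! p = snd x ! q) * f x * v x) = (\<Sum>x\<in>D. f x * v x)"
    unfolding D_def by (rule sum.mono_neutral_cong_right) auto
  show ?thesis
  proof (cases "N = 0")
    case True
    then have "D = {}"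
      using pq by (auto simp: D_def idxs_eq dest: nth_tuples)
    then show ?thesis using D by simp
  next
    case False
    have nth_D: "fst x ! p < N" if "x \<in> D" for x
      using that pq by (auto simp: D_def idxs_eq nth_tuples)
    have upd_D: "upd x t \<in> D" "upd (upd x t) (fst x ! p) = x" "fst (upd x t) ! p = t"
      if "x \<in> D" "t < N" for x t
      using that pq
      by (auto simp: D_def upd_def idxs_eq list_update_tuples length_tuples nth_tuples)
        (metis length_tuples list_update_id)+
    have "of_nat N * (\<Sum>x\<in>D. f x * v x) = (\<Sum>(x, t)\<in>D \<times> {..<N}. f x * v x)"
      by (simp add: sum.cartesian_product[symmetric] sum_distrib_left)
    also have "\<dots> = (\<Sum>(x, t)\<in>D \<times> {..<N}. f (upd x t) * v (upd x t))"
      by (rule sum.reindex_bij_witness[of _ "\<lambda>(x, t). (upd x t, fst x ! p)" "\<lambda>(x, t). (upd x t, fst x ! p)"])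
        (simp_all add: case_prod_unfold mem_Times_iff upd_D nth_D)
    also have "\<dots> = (\<Sum>x\<in>D. f x * (\<Sum>t<N. v (upd x t)))"
      unfolding sum_distrib_left sum.cartesian_product
      using f by (intro sum.cong) (auto simp: upd_def D_def)
    also have "\<dots> = 0"
      using V0_update[OF v pq] by (intro sum.neutral) (auto simp: D_def upd_def)
    finally show ?thesis
      using D False by simp
  qed
qed

interpretation cscale: vector_space cscale
  by unfold_locales (auto simp: cscale_def fun_eq_iff algebra_simps)

lemma sum_fun_eq: "(\<Sum>j\<in>K. g j) = (\<lambda>x. \<Sum>j\<in>K. g j x :: 'b :: comm_monoid_add)"
  by (induction K rule: infinite_finite_induct) (auto simp: fun_eq_iff)

lemma subspace_vecs: "cscale.subspace (vecs m n N)"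
  by (auto simp: cscale.subspace_def vecs_def cscale_def)

lemma subspace_V0: "cscale.subspace (V0 m n N)"
proof -
  have "tr m n N p q (u + v) = tr m n N p q u + tr m n N p q v"
    "tr m n N p q (cscale c v) = cscale c (tr m n N p q v)"
    "tr m n N p q 0 = 0" for p q c and u v :: "idx \<Rightarrow> complex"
    by (auto simp: tr_def fun_eq_iff sum.distrib cscale_def sum_distrib_left)
  then show ?thesis
    using subspace_vecs[of m n N]
    by (auto simp: cscale.subspace_def V0_def vzero_def fun_eq_iff cscale_def)
qed

lemma subspace_V1: "cscale.subspace (V1 m n N)"
  by (simp add: V1_def)

lemma V0_vecs: "v \<in> V0 m n N \<Longrightarrow> v \<in> vecs m n N"
  by (simp add: V0_def)

lemma V1_vecs: "v \<in> V1 m n N \<Longrightarrow> v \<in> vecs m n N"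
proof -
  have "V1 m n N \<subseteq> vecs m n N"
    unfolding V1_def by (intro cscale.span_minimal subspace_vecs) (auto simp: trp_def vecs_def)
  then show "v \<in> V1 m n N \<Longrightarrow> v \<in> vecs m n N" by blast
qed

text \<open>An insertion is supported on indices agreeing at \<open>p\<close> and \<open>q\<close>
  and ignores their common value, so its pairing with \<open>v\<close> is an instance of
  \<open>V0_contraction_sum\<close>.\<close>

lemma V1_orthogonal_V0:
  assumes u: "u \<in> V1 m n N" and v: "v \<in> V0 m n N"
  shows "hinner (idxs m n N) u v = 0"
proof -
  have "V1 m n N \<subseteq> {u. hinner (idxs m n N) u v = 0}"
    unfolding V1_def
  proof (rule cscale.span_minimal)
    show "cscale.subspace {u. hinner (idxs m n N) u v = 0}"
      by (auto simp: cscale.subspace_def hinner_def cscale_def algebra_simps sum.distrib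
          simp flip: sum_distrib_left)
    have "hinner (idxs m n N) (trp m n N p q w) v = 0" if pq: "p < m" "q < n" for p q w
    proof -
      have "hinner (idxs m n N) (trp m n N p q w) v
          = (\<Sum>x\<in>idxs m n N. of_bool (fst x ! p = snd x ! q) * cnj (w (del p (fst x), del q (snd x))) * v x)"
        unfolding hinner_def by (intro sum.cong) (auto simp: trp_def)
      also have "\<dots> = 0"
        by (rule V0_contraction_sum[OF v pq]) (simp add: del_update)
      finally show ?thesis .
    qed
    then show "{trp m n N p q w | p q w. p < m \<and> q < n \<and> w \<in> vecs (m - 1) (n - 1) N}
        \<subseteq> {u. hinner (idxs m n N) u v = 0}"
      by auto
  qed
  then show ?thesis using u by auto
qed

lemma hinner_self_vecs_eq_0:
  assumes "v \<in> vecs m n N" "hinner (idxs m n N) v v = 0"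
  shows "v = 0"
proof
  fix x
  show "v x = 0 x"
    using hinner_self_eq_0[OF finite_idxs assms(2), of x] assms(1)
    by (cases "x \<in> idxs m n N") (simp_all add: vecs_def del: split_paired_All)
qed

lemma V0_V1_disjoint: "v \<in> V0 m n N \<Longrightarrow> v \<in> V1 m n N \<Longrightarrow> v = 0"
  using V1_orthogonal_V0 V0_vecs hinner_self_vecs_eq_0 by blast

text \<open>Here \<open>u\<close> is the orthogonal projection of \<open>v\<close> to
  \<open>V1\<close>, computed from the insertions of basis vectors.\<close>

lemma V0_V1_decomposition:
  assumes v: "v \<in> vecs m n N"
  shows "\<exists>u\<in>V1 m n N. v - u \<in> V0 m n N"
proof -
  define K where "K = {..<m} \<times> {..<n} \<times> idxs (m - 1) (n - 1) N"
  define b where "b = (\<lambda>(p, q, z). trp m n N p q (\<lambda>x. of_bool (x = z)))"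
  have "finite K" by (simp add: K_def)
  then obtain c where c: "\<forall>j\<in>K. hinner (idxs m n N) (b j) (\<lambda>x. v x - (\<Sum>l\<in>K. c l * b l x)) = 0"
    using projection_coefficients_exist[of K "idxs m n N" b v] by auto
  define u where "u = (\<Sum>l\<in>K. cscale (c l) (b l))"
  have u: "u \<in> V1 m n N"
    unfolding u_def V1_def
  proof (intro cscale.span_sum cscale.span_scale cscale.span_base)
    fix l assume "l \<in> K"
    then obtain p q z where l: "l = (p, q, z)" and pqz: "p < m" "q < n" "z \<in> idxs (m - 1) (n - 1) N"
      by (cases l) (auto simp: K_def)
    have "(\<lambda>x. of_bool (x = z)) \<in> vecs (m - 1) (n - 1) N"
      using pqz(3) by (auto simp: vecs_def)
    then show "b l \<in> {trp m n N p q w | p q w. p < m \<and> q < n \<and> w \<in> vecs (m - 1) (n - 1) N}"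
      using pqz(1,2) unfolding l b_def by auto
  qed
  have r: "v - u = (\<lambda>x. v x - (\<Sum>l\<in>K. c l * b l x))"
    by (simp add: fun_eq_iff u_def sum_fun_eq cscale_def)
  have "tr m n N p q (v - u) (x, y) = 0" if pq: "p < m" "q < n" for p q x y
  proof (cases "(x, y) \<in> idxs (m - 1) (n - 1) N")
    case True
    then have len: "p \<le> length x" "q \<le> length y"
      using pq by (auto simp: idxs_eq length_tuples)
    \<comment> \<open>Adjointness: pairing with the insertion of a basis vector reads off one entry
      of the trace.\<close>
    have "0 = hinner (idxs m n N) (b (p, q, (x, y))) (v - u)"
      using c pq True unfolding r by (simp add: K_def)
    also have "\<dots> = (\<Sum>z | z \<in> idxs m n N \<and> fst z ! p = snd z ! q \<and> del p (fst z) = x \<and> del q (snd z) = y. (v - u) z)"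
      unfolding hinner_def b_def
      by (rule sum.mono_neutral_cong_right) (auto simp: trp_def split: prod.splits)
    also have "\<dots> = (\<Sum>t<N. (v - u) (ins p t x, ins q t y))"
      using pq True len
      by (intro sum.reindex_bij_witness[of _ "\<lambda>t. (ins p t x, ins q t y)" "\<lambda>z. fst z ! p"])
        (auto simp: idxs_eq ins_tuples nth_ins del_ins nth_tuples length_tuples ins_nth_del;
          metis ins_nth_del length_tuples)+
    also have "\<dots> = tr m n N p q (v - u) (x, y)"
      using True by (simp add: tr_def)
    finally show ?thesis by simp
  qed (simp add: tr_def)
  moreover have "v - u \<in> vecs m n N"
    using v V1_vecs[OF u] by (auto simp: vecs_def)
  ultimately have "v - u \<in> V0 m n N"
    by (auto simp: V0_def vzero_def fun_eq_iff)
  then show ?thesis using u by blast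
qed

text \<open>The \<open>V0\<close>-component of \<open>u\<close> is orthogonal both to
  \<open>u\<close> and to the \<open>V1\<close>-component, hence to itself.\<close>

lemma V1I_orthogonal:
  assumes u: "u \<in> vecs m n N" and orth: "\<And>v. v \<in> V0 m n N \<Longrightarrow> hinner (idxs m n N) v u = 0"
  shows "u \<in> V1 m n N"
proof -
  obtain w where w: "w \<in> V1 m n N" "u - w \<in> V0 m n N"
    using V0_V1_decomposition[OF u] by blast
  have "hinner (idxs m n N) (u - w) w = 0"
    using V1_orthogonal_V0[OF w] hinner_cnj[of _ "u - w" w] by simp
  moreover have "hinner (idxs m n N) (u - w) (u - w)
      = hinner (idxs m n N) (u - w) u - hinner (idxs m n N) (u - w) w"
    using hinner_diff_right[of _ "u - w" u w] by (simp add: fun_diff_def)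
  ultimately have "u - w = 0"
    using orth[OF w(2)] hinner_self_vecs_eq_0[OF V0_vecs[OF w(2)]] by simp
  then show ?thesis using w(1) by simp
qed

section \<open>Operators preserving the traceless subspace\<close>

lemma app_vecs: "M \<in> mats m n N \<Longrightarrow> app m n N M v \<in> vecs m n N"
  by (simp add: mats_def vecs_def app_def del: split_paired_All)

definition madj :: "(idx \<Rightarrow> idx \<Rightarrow> complex) \<Rightarrow> idx \<Rightarrow> idx \<Rightarrow> complex" where
  "madj M = (\<lambda>x y. cnj (M y x))"

lemma madj_mats: "M \<in> mats m n N \<Longrightarrow> madj M \<in> mats m n N"
  by (simp add: mats_def madj_def del: split_paired_All) blast

lemma hinner_app: "hinner (idxs m n N) u (app m n N M v) = hinner (idxs m n N) (app m n N (madj M) u) v"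
  unfolding hinner_def app_def madj_def
  by (simp add: sum_distrib_left sum_distrib_right mult_ac) (rule sum.swap)

text \<open>Since \<open>V1\<close> is the orthogonal complement of \<open>V0\<close>, moving
  \<open>M\<close> across the inner product suffices.\<close>

lemma V1_preserved_if_adjoint_preserves_V0:
  assumes "M \<in> mats m n N" "\<And>v. v \<in> V0 m n N \<Longrightarrow> app m n N (madj M) v \<in> V0 m n N"
    and u: "u \<in> V1 m n N"
  shows "app m n N M u \<in> V1 m n N"
proof (rule V1I_orthogonal[OF app_vecs[OF assms(1)]])
  fix v assume "v \<in> V0 m n N"
  then have "hinner (idxs m n N) u (app m n N (madj M) v) = 0"
    by (intro V1_orthogonal_V0[OF u] assms(2))
  then show "hinner (idxs m n N) v (app m n N M u) = 0"
    using hinner_app[of m n N v M u] hinner_cnj[of "idxs m n N" "app m n N (madj M) v" u] by simp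
qed

section \<open>Walled Brauer diagrams encoded by permutations\<close>

lemma permute_list_eq_iff_inv:
  assumes "\<sigma> permutes {..<length xs}" "length ys = length xs"
  shows "ys = permute_list \<sigma> xs \<longleftrightarrow> xs = permute_list (Hilbert_Choice.inv \<sigma>) ys"
proof
  assume ys: "ys = permute_list \<sigma> xs"
  have "permute_list (Hilbert_Choice.inv \<sigma>) ys = permute_list (\<sigma> \<circ> Hilbert_Choice.inv \<sigma>) xs"
    unfolding ys using assms(1) by (intro permute_list_compose[symmetric] permutes_inv)
  then show "xs = permute_list (Hilbert_Choice.inv \<sigma>) ys"
    using assms(1) by (simp add: permutes_inv_o)
next
  assume xs: "xs = permute_list (Hilbert_Choice.inv \<sigma>) ys"
  have "permute_list \<sigma> xs = permute_list (Hilbert_Choice.inv \<sigma> \<circ> \<sigma>) ys"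
    unfolding xs using assms by (intro permute_list_compose[symmetric]) simp
  then show "ys = permute_list \<sigma> xs"
    using assms(1) by (simp add: permutes_inv_o)
qed

text \<open>\<open>permute_list \<sigma>\<close> reads its entry \<open>i\<close> at position
  \<open>\<sigma> i\<close>, so the entry at \<open>p\<close> lands at the preimage of
  \<open>p\<close>.\<close>

lemma permute_list_update:
  assumes "\<sigma> permutes {..<length xs}" "p < length xs"
  shows "permute_list \<sigma> (xs[p := t]) = (permute_list \<sigma> xs)[Hilbert_Choice.inv \<sigma> p := t]"
proof (rule nth_equalityI)
  fix i assume i: "i < length (permute_list \<sigma> (xs[p := t]))"
  then have "\<sigma> i < length xs"
    using permutes_in_image[OF assms(1)] by simp
  moreover have "Hilbert_Choice.inv \<sigma> p = i \<longleftrightarrow> p = \<sigma> i"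
    using permutes_inv_eq[OF assms(1)] by auto
  ultimately show "permute_list \<sigma> (xs[p := t]) ! i = (permute_list \<sigma> xs)[Hilbert_Choice.inv \<sigma> p := t] ! i"
    using assms i by (simp add: permute_list_nth nth_list_update)
qed simp

text \<open>The permutation operators with the partial transpose undone; \<open>(a', b')\<close> is
  the input and \<open>(a, b)\<close> the output. For \<open>i < m\<close>, the input slot
  \<open>i\<close> is joined to an output slot of V if \<open>\<sigma> i < m\<close>, and to the
  dual input slot \<open>\<sigma> i - m\<close> otherwise, which is a contraction.\<close>

definition diagram_sum :: "nat \<Rightarrow> nat \<Rightarrow> nat \<Rightarrow> ((nat \<Rightarrow> nat) \<Rightarrow> complex) \<Rightarrow> (idx \<Rightarrow> idx \<Rightarrow> complex) \<Rightarrow> bool" where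
  "diagram_sum m n N c M \<longleftrightarrow> M \<in> mats m n N \<and>
    (\<forall>(a, b)\<in>idxs m n N. \<forall>(a', b')\<in>idxs m n N.
      M (a, b) (a', b') = (\<Sum>\<sigma> | \<sigma> permutes {..<m+n}. c \<sigma> * of_bool (a' @ b = permute_list \<sigma> (a @ b'))))"

lemma Cmn_diagram_sum_ex:
  assumes "M \<in> Cmn m n N"
  shows "\<exists>c. diagram_sum m n N c M"
proof -
  have "tcomm (m + n) N (ptrans m M) g" for g
    using tcomm_all_if_tcomm_GL tcomm_ptrans[OF assms] by blast
  then obtain c where c: "\<And>u w. u \<in> tuples (m + n) N \<Longrightarrow> w \<in> tuples (m + n) N \<Longrightarrow>
      ptrans m M u w = (\<Sum>\<sigma> | \<sigma> permutes {..<m+n}. c \<sigma> * of_bool (w = permute_list \<sigma> u))"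
    using schur_weyl by blast
  have "M (a, b) (a', b') = (\<Sum>\<sigma> | \<sigma> permutes {..<m+n}. c \<sigma> * of_bool (a' @ b = permute_list \<sigma> (a @ b')))"
    if "(a, b) \<in> idxs m n N" "(a', b') \<in> idxs m n N" for a b a' b'
    using c[of "a @ b'" "a' @ b"] that
    by (auto simp: ptrans_def idxs_eq append_tuples length_tuples)
  then show ?thesis
    using assms by (auto simp: diagram_sum_def Cmn_def)
qed

text \<open>Reflecting a diagram exchanges input and output, which inverts the permutation.\<close>

lemma diagram_sum_madj:
  assumes "diagram_sum m n N c M"
  shows "diagram_sum m n N (\<lambda>\<sigma>. cnj (c (Hilbert_Choice.inv \<sigma>))) (madj M)"
proof -
  have "madj M (a, b) (a', b')
      = (\<Sum>\<sigma> | \<sigma> permutes {..<m+n}. cnj (c (Hilbert_Choice.inv \<sigma>)) * of_bool (a' @ b = permute_list \<sigma> (a @ b')))"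
    if ab: "(a, b) \<in> idxs m n N" "(a', b') \<in> idxs m n N" for a b a' b'
  proof -
    have M: "M (a', b') (a, b)
        = (\<Sum>\<sigma> | \<sigma> permutes {..<m+n}. c \<sigma> * of_bool (a @ b' = permute_list \<sigma> (a' @ b)))"
      using assms ab unfolding diagram_sum_def by fastforce
    have "madj M (a, b) (a', b')
        = (\<Sum>\<sigma> | \<sigma> permutes {..<m+n}. cnj (c \<sigma>) * of_bool (a @ b' = permute_list \<sigma> (a' @ b)))"
      by (simp add: madj_def M of_bool_def if_distrib cong: if_cong)
    also have "\<dots> = (\<Sum>\<sigma> | \<sigma> permutes {..<m+n}. cnj (c (Hilbert_Choice.inv \<sigma>)) * of_bool (a @ b' = permute_list (Hilbert_Choice.inv \<sigma>) (a' @ b)))"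
      by (rule sum_permutations_inverse)
    also have "\<dots> = (\<Sum>\<sigma> | \<sigma> permutes {..<m+n}. cnj (c (Hilbert_Choice.inv \<sigma>)) * of_bool (a' @ b = permute_list \<sigma> (a @ b')))"
    proof (intro sum.cong refl)
      fix \<sigma> assume "\<sigma> \<in> {\<sigma>. \<sigma> permutes {..<m+n}}"
      then have "a' @ b = permute_list \<sigma> (a @ b') \<longleftrightarrow> a @ b' = permute_list (Hilbert_Choice.inv \<sigma>) (a' @ b)"
        using ab by (intro permute_list_eq_iff_inv) (auto simp: idxs_eq length_tuples)
      then show "cnj (c (Hilbert_Choice.inv \<sigma>)) * of_bool (a @ b' = permute_list (Hilbert_Choice.inv \<sigma>) (a' @ b))
          = cnj (c (Hilbert_Choice.inv \<sigma>)) * of_bool (a' @ b = permute_list \<sigma> (a @ b'))"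
        by simp
    qed
    finally show ?thesis .
  qed
  then show ?thesis
    using assms by (auto simp: diagram_sum_def madj_mats)
qed

text \<open>The equation at position \<open>i\<close> is the contraction of the input slots
  \<open>i\<close> and \<open>j\<close>; all other equations form the factor \<open>f\<close>, so
  \<open>V0_contraction_sum\<close> applies.\<close>

lemma diagram_contracting:
  assumes v: "v \<in> V0 m n N" and \<sigma>: "\<sigma> permutes {..<m+n}"
    and i: "i < m" "m \<le> \<sigma> i" and ab: "(a, b) \<in> idxs m n N"
  shows "(\<Sum>x\<in>idxs m n N. of_bool (fst x @ b = permute_list \<sigma> (a @ snd x)) * v x) = 0"
proof -
  define j where "j = \<sigma> i - m"
  define f where "f x = (of_bool (\<forall>k<m+n. k \<noteq> i \<longrightarrow> (fst x @ b) ! k = (a @ snd x) ! \<sigma> k) :: complex)" for x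
  have si: "\<sigma> i = m + j" using i by (simp add: j_def)
  have j: "j < n"
    using permutes_in_image[OF \<sigma>, of i] i si by simp
  have len: "length a = m" "length b = n"
    using ab by (auto simp: idxs_eq length_tuples)
  have "of_bool (fst x @ b = permute_list \<sigma> (a @ snd x)) = of_bool (fst x ! i = snd x ! j) * f x"
    if "x \<in> idxs m n N" for x
  proof -
    have lx: "length (fst x) = m" "length (snd x) = n"
      using that by (auto simp: idxs_eq length_tuples)
    then have "fst x @ b = permute_list \<sigma> (a @ snd x)
        \<longleftrightarrow> (\<forall>k<m+n. (fst x @ b) ! k = (a @ snd x) ! \<sigma> k)"
      using \<sigma> len by (auto simp: list_eq_iff_nth_eq permute_list_nth)
    also have "\<dots> \<longleftrightarrow> (fst x @ b) ! i = (a @ snd x) ! \<sigma> i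
        \<and> (\<forall>k<m+n. k \<noteq> i \<longrightarrow> (fst x @ b) ! k = (a @ snd x) ! \<sigma> k)"
      using i by auto
    also have "(fst x @ b) ! i = (a @ snd x) ! \<sigma> i \<longleftrightarrow> fst x ! i = snd x ! j"
      using i lx len si by (simp add: nth_append)
    finally show ?thesis by (simp add: f_def)
  qed
  then have "(\<Sum>x\<in>idxs m n N. of_bool (fst x @ b = permute_list \<sigma> (a @ snd x)) * v x)
      = (\<Sum>x\<in>idxs m n N. of_bool (fst x ! i = snd x ! j) * f x * v x)"
    by (intro sum.cong) auto
  also have "\<dots> = 0"
  proof (rule V0_contraction_sum[OF v i(1) j])
    fix a' b' t assume "(a', b') \<in> idxs m n N"
    then have la': "length a' = m" by (auto simp: idxs_eq length_tuples)
    \<comment> \<open>As \<open>\<sigma>\<close> is injective, \<open>m + j\<close> is read at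
      \<open>k = i\<close> only, so \<open>f\<close> does not see the overwritten entries.\<close>
    have "(a'[i := t] @ b) ! k = (a' @ b) ! k \<and> (a @ b'[j := t]) ! \<sigma> k = (a @ b') ! \<sigma> k"
      if "k \<noteq> i" for k
    proof -
      have "\<sigma> k \<noteq> m + j"
        using that si permutes_inj[OF \<sigma>] by (metis injD)
      moreover have "a'[i := t] @ b = (a' @ b)[i := t]" "a @ b'[j := t] = (a @ b')[m + j := t]"
        using i la' len by (simp_all add: list_update_append)
      ultimately show ?thesis
        using that by simp
    qed
    then show "f (a'[i := t], b'[j := t]) = f (a', b')"
      by (simp add: f_def cong: conj_cong)
  qed
  finally show ?thesis .
qed

text \<open>Such a \<open>\<sigma>\<close> splits as \<open>\<sigma>'\<close> on the V-slots and
  \<open>\<tau>\<close> on the dual slots. The operator merely relabels slots, so a trace of the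
  image is a trace of \<open>v\<close> at the relabelled pair.\<close>

lemma diagram_noncontracting:
  assumes v: "v \<in> V0 m n N" and \<sigma>: "\<sigma> permutes {..<m+n}"
    and i: "\<And>i. i < m \<Longrightarrow> \<sigma> i < m" and ab: "(a, b) \<in> idxs m n N" and pq: "p < m" "q < n"
  shows "(\<Sum>t<N. \<Sum>x\<in>idxs m n N.
      of_bool (fst x @ b[q := t] = permute_list \<sigma> (a[p := t] @ snd x)) * v x) = 0"
proof -
  define \<sigma>' where "\<sigma>' k = (if k < m then \<sigma> k else k)" for k
  define \<tau> where "\<tau> l = (if l < n then \<sigma> (m + l) - m else l)" for l
  have inj: "\<sigma> k = \<sigma> l \<longleftrightarrow> k = l" for k l
    using permutes_inj[OF \<sigma>] by (auto dest: injD)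
  \<comment> \<open>An injective self-map of a finite set is onto, so \<open>\<sigma>\<close>
    preserves the dual slots as well.\<close>
  have im: "\<sigma> ` {..<m} = {..<m}"
    using i by (intro endo_inj_surj) (auto simp: inj_on_def inj)
  have hi: "m \<le> \<sigma> (m + l)" for l
  proof (rule ccontr)
    assume "\<not> m \<le> \<sigma> (m + l)"
    then have "\<sigma> (m + l) \<in> \<sigma> ` {..<m}" using im by simp
    then show False using inj by auto
  qed
  have hi': "\<sigma> (m + l) < m + n" if "l < n" for l
    using permutes_in_image[OF \<sigma>, of "m + l"] that by simp
  have "\<sigma>' ` {..<m} = {..<m}" using im by (auto simp: \<sigma>'_def)
  then have \<sigma>': "\<sigma>' permutes {..<m}"
    by (intro bij_imp_permutes) (auto simp: bij_betw_def inj_on_def \<sigma>'_def inj)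
  have \<tau>_inj: "inj_on \<tau> {..<n}"
  proof (rule inj_onI)
    fix k l assume "k \<in> {..<n}" "l \<in> {..<n}" "\<tau> k = \<tau> l"
    then have "\<sigma> (m + k) = \<sigma> (m + l)"
      using hi[of k] hi[of l] by (simp add: \<tau>_def)
    then show "k = l" by (simp add: inj)
  qed
  have "\<tau> l < n" if "l < n" for l
    using hi'[OF that] hi[of l] that by (simp add: \<tau>_def)
  then have "\<tau> ` {..<n} = {..<n}"
    using \<tau>_inj by (intro endo_inj_surj) auto
  then have \<tau>: "\<tau> permutes {..<n}"
    using \<tau>_inj by (intro bij_imp_permutes) (auto simp: bij_betw_def \<tau>_def)
  have D: "(\<Sum>x\<in>idxs m n N. of_bool (fst x @ b = permute_list \<sigma> (a @ snd x)) * v x)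
      = v (permute_list \<sigma>' a, permute_list (Hilbert_Choice.inv \<tau>) b)" if ab: "(a, b) \<in> idxs m n N" for a b
  proof -
    have len: "length a = m" "length b = n"
      using ab by (auto simp: idxs_eq length_tuples)
    have eq: "fst x @ b = permute_list \<sigma> (a @ snd x) \<longleftrightarrow> x = (permute_list \<sigma>' a, permute_list (Hilbert_Choice.inv \<tau>) b)"
      if "x \<in> idxs m n N" for x
    proof -
      have lx: "length (fst x) = m" "length (snd x) = n"
        using that by (auto simp: idxs_eq length_tuples)
      have "permute_list \<sigma> (a @ snd x) = permute_list \<sigma>' a @ permute_list \<tau> (snd x)"
      proof (rule nth_equalityI)
        fix k assume "k < length (permute_list \<sigma> (a @ snd x))"
        then have k: "k < m + n" using len lx by simp
        show "permute_list \<sigma> (a @ snd x) ! k = (permute_list \<sigma>' a @ permute_list \<tau> (snd x)) ! k"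
        proof (cases "k < m")
          case True
          then show ?thesis
            using k len lx \<sigma> \<sigma>' i[of k] by (simp add: permute_list_nth nth_append) (simp add: \<sigma>'_def)
        next
          case False
          then obtain l where l: "k = m + l" "l < n"
            using k by (metis add_less_cancel_left le_Suc_ex not_less)
          then show ?thesis
            using k len lx \<sigma> \<tau> hi[of l] by (simp add: permute_list_nth nth_append) (simp add: \<tau>_def)
        qed
      qed simp
      then have "fst x @ b = permute_list \<sigma> (a @ snd x) \<longleftrightarrow> fst x = permute_list \<sigma>' a \<and> b = permute_list \<tau> (snd x)"
        using len lx by simp
      also have "b = permute_list \<tau> (snd x) \<longleftrightarrow> snd x = permute_list (Hilbert_Choice.inv \<tau>) b"
        using \<tau> len lx by (intro permute_list_eq_iff_inv) auto
      finally show ?thesis by (simp add: prod_eq_iff)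
    qed
    have "(permute_list \<sigma>' a, permute_list (Hilbert_Choice.inv \<tau>) b) \<in> idxs m n N"
      using ab \<sigma>' permutes_inv[OF \<tau>] by (auto simp: idxs_eq permute_list_tuples)
    moreover have "(\<Sum>x\<in>idxs m n N. of_bool (fst x @ b = permute_list \<sigma> (a @ snd x)) * v x)
        = (\<Sum>x\<in>idxs m n N. if x = (permute_list \<sigma>' a, permute_list (Hilbert_Choice.inv \<tau>) b) then v x else 0)"
      by (intro sum.cong) (auto simp: eq)
    ultimately show ?thesis by simp
  qed
  have len: "length a = m" "length b = n"
    using ab by (auto simp: idxs_eq length_tuples)
  have "(\<Sum>t<N. \<Sum>x\<in>idxs m n N. of_bool (fst x @ b[q := t] = permute_list \<sigma> (a[p := t] @ snd x)) * v x)
      = (\<Sum>t<N. v ((permute_list \<sigma>' a)[Hilbert_Choice.inv \<sigma>' p := t], (permute_list (Hilbert_Choice.inv \<tau>) b)[Hilbert_Choice.inv (Hilbert_Choice.inv \<tau>) q := t]))"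
  proof (intro sum.cong[OF refl])
    fix t assume "t \<in> {..<N}"
    then have "(a[p := t], b[q := t]) \<in> idxs m n N"
      using ab by (simp add: idxs_eq list_update_tuples)
    from D[OF this]
    show "(\<Sum>x\<in>idxs m n N. of_bool (fst x @ b[q := t] = permute_list \<sigma> (a[p := t] @ snd x)) * v x)
        = v ((permute_list \<sigma>' a)[Hilbert_Choice.inv \<sigma>' p := t],
            (permute_list (Hilbert_Choice.inv \<tau>) b)[Hilbert_Choice.inv (Hilbert_Choice.inv \<tau>) q := t])"
      using pq len \<sigma>' permutes_inv[OF \<tau>] by (simp only: permute_list_update)
  qed
  also have "\<dots> = 0"
  proof (rule V0_update[OF v])
    show "Hilbert_Choice.inv \<sigma>' p < m"
      using permutes_in_image[OF permutes_inv[OF \<sigma>'], of p] pq by simp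
    show "Hilbert_Choice.inv (Hilbert_Choice.inv \<tau>) q < n"
      using permutes_in_image[OF permutes_inv[OF permutes_inv[OF \<tau>]], of q] pq by simp
    show "(permute_list \<sigma>' a, permute_list (Hilbert_Choice.inv \<tau>) b) \<in> idxs m n N"
      using ab \<sigma>' permutes_inv[OF \<tau>] by (auto simp: idxs_eq permute_list_tuples)
  qed
  finally show ?thesis .
qed

lemma diagram_sum_preserves_V0:
  assumes M: "diagram_sum m n N c M" and v: "v \<in> V0 m n N"
  shows "app m n N M v \<in> V0 m n N"
proof (rule V0I)
  show "app m n N M v \<in> vecs m n N"
    using M by (auto simp: diagram_sum_def app_vecs)
  fix p q a b assume pq: "p < m" "q < n" and ab: "(a, b) \<in> idxs m n N"
  define D where "D \<sigma> t = (\<Sum>x\<in>idxs m n N.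
      of_bool (fst x @ b[q := t] = permute_list \<sigma> (a[p := t] @ snd x)) * v x)" for \<sigma> t
  have abt: "(a[p := t], b[q := t]) \<in> idxs m n N" if "t < N" for t
    using ab that by (simp add: idxs_eq list_update_tuples)
  have "(\<Sum>t<N. app m n N M v (a[p := t], b[q := t]))
      = (\<Sum>t<N. \<Sum>x\<in>idxs m n N. \<Sum>\<sigma> | \<sigma> permutes {..<m+n}.
          c \<sigma> * (of_bool (fst x @ b[q := t] = permute_list \<sigma> (a[p := t] @ snd x)) * v x))"
    unfolding app_def
  proof (intro sum.cong[OF refl])
    fix t x assume t: "t \<in> {..<N}" and x: "x \<in> idxs m n N"
    obtain a' b' where x': "x = (a', b')" by (cases x)
    have "M (a[p := t], b[q := t]) x = (\<Sum>\<sigma> | \<sigma> permutes {..<m+n}.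
        c \<sigma> * of_bool (fst x @ b[q := t] = permute_list \<sigma> (a[p := t] @ snd x)))"
      using M abt[of t] t x unfolding diagram_sum_def x' by fastforce
    then show "M (a[p := t], b[q := t]) x * v x = (\<Sum>\<sigma> | \<sigma> permutes {..<m+n}.
        c \<sigma> * (of_bool (fst x @ b[q := t] = permute_list \<sigma> (a[p := t] @ snd x)) * v x))"
      by (simp add: sum_distrib_right mult.assoc)
  qed
  also have "\<dots> = (\<Sum>\<sigma> | \<sigma> permutes {..<m+n}. c \<sigma> * (\<Sum>t<N. D \<sigma> t))"
    unfolding D_def sum_distrib_left by (simp only: sum.swap[of _ "{\<sigma>. \<sigma> permutes {..<m+n}}"])
  also have "\<dots> = 0"
  proof (intro sum.neutral ballI)
    fix \<sigma> assume "\<sigma> \<in> {\<sigma>. \<sigma> permutes {..<m+n}}"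
    then have \<sigma>: "\<sigma> permutes {..<m+n}" by simp
    show "c \<sigma> * (\<Sum>t<N. D \<sigma> t) = 0"
    proof (cases "\<forall>i<m. \<sigma> i < m")
      case True
      then show ?thesis
        using diagram_noncontracting[OF v \<sigma> _ ab pq] by (simp add: D_def)
    next
      case False
      then obtain i where "i < m" "m \<le> \<sigma> i" by (meson not_less)
      then show ?thesis
        using diagram_contracting[OF v \<sigma>] abt by (simp add: D_def)
    qed
  qed
  finally show "(\<Sum>t<N. app m n N M v (a[p := t], b[q := t])) = 0" .
qed

section \<open>Invariance of the traceless subspace under the group\<close>

lemma tpow_split:
  assumes "p < k"
  shows "tpow k g u w = g (u ! p) (w ! p) * (\<Prod>i\<in>{..<k} - {p}. g (u ! i) (w ! i))"
  unfolding tpow_def using assms by (simp add: prod.remove)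

lemma rho_mats: "rho m n N g h \<in> mats m n N"
  by (auto simp: rho_def mats_def)

text \<open>Contraction is equivariant: tracing the slots \<open>p\<close> and \<open>q\<close> of
  the transformed vector pairs one factor \<open>g\<close> with one factor \<open>h\<close>, and
  \<open>h g = 1\<close> leaves a contraction of \<open>v\<close> with the weight \<open>f\<close>
  of the other slots.\<close>

lemma rho_preserves_V0:
  assumes gh: "(g, h) \<in> GL N" and v: "v \<in> V0 m n N"
  shows "app m n N (rho m n N g h) v \<in> V0 m n N"
proof (rule V0I[OF app_vecs[OF rho_mats]])
  fix p q a b assume pq: "p < m" "q < n" and ab: "(a, b) \<in> idxs m n N"
  define f where "f x = (\<Prod>i\<in>{..<m} - {p}. g (a ! i) (fst x ! i)) * (\<Prod>i\<in>{..<n} - {q}. h (snd x ! i) (b ! i))" for x :: idx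
  have len: "length a = m" "length b = n"
    using ab by (auto simp: idxs_eq length_tuples)
  have abt: "(a[p := t], b[q := t]) \<in> idxs m n N" if "t < N" for t
    using ab that by (simp add: idxs_eq list_update_tuples)
  have rho: "rho m n N g h (a[p := t], b[q := t]) x = h (snd x ! q) t * g t (fst x ! p) * f x"
    if "t < N" "x \<in> idxs m n N" for t x
    using abt[OF that(1)] that(2) pq len
    by (simp add: rho_tpow tpow_split[OF pq(1)] tpow_split[OF pq(2)] f_def mult_ac)
  have "(\<Sum>t<N. app m n N (rho m n N g h) v (a[p := t], b[q := t]))
      = (\<Sum>t<N. \<Sum>x\<in>idxs m n N. h (snd x ! q) t * g t (fst x ! p) * f x * v x)"
    unfolding app_def by (intro sum.cong refl) (simp add: rho)
  also have "\<dots> = (\<Sum>x\<in>idxs m n N. (\<Sum>t<N. h (snd x ! q) t * g t (fst x ! p)) * f x * v x)"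
    unfolding sum_distrib_right by (rule sum.swap)
  also have "\<dots> = (\<Sum>x\<in>idxs m n N. of_bool (fst x ! p = snd x ! q) * f x * v x)"
    using GL_swap[OF gh] pq
    by (intro sum.cong refl) (auto simp: GL_def idxs_eq nth_tuples)
  also have "\<dots> = 0"
  proof (rule V0_contraction_sum[OF v pq])
    show "f (a'[p := t], b'[q := t]) = f (a', b')" for a' b' t
      unfolding f_def by (intro arg_cong2[where f = "(*)"] prod.cong) auto
  qed
  finally show "(\<Sum>t<N. app m n N (rho m n N g h) v (a[p := t], b[q := t])) = 0" .
qed

lemma madj_rho: "madj (rho m n N g h) = rho m n N (\<lambda>i j. cnj (g j i)) (\<lambda>i j. cnj (h j i))"
  by (auto simp: madj_def rho_def fun_eq_iff)

text \<open>The product of the adjoints is the adjoint of \<open>h g\<close>, not of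
  \<open>g h\<close>, hence the appeal to \<open>GL_swap\<close>.\<close>

lemma GL_adjoint:
  assumes "(g, h) \<in> GL N"
  shows "(\<lambda>i j. cnj (g j i), \<lambda>i j. cnj (h j i)) \<in> GL N"
proof -
  have "(\<Sum>k<N. cnj (g k i) * cnj (h j k)) = (if i = j then 1 else 0)" if "i < N" "j < N" for i j
  proof -
    have "(\<Sum>k<N. cnj (g k i) * cnj (h j k)) = cnj (\<Sum>k<N. h j k * g k i)"
      by (simp add: mult.commute)
    also have "(\<Sum>k<N. h j k * g k i) = (if j = i then 1 else 0)"
      using GL_swap[OF assms] that by (simp add: GL_def)
    finally show ?thesis by simp
  qed
  then show ?thesis by (simp add: GL_def)
qed

section \<open>The matrix algebra\<close>

lemma madd_eq_plus: "madd A B = A + B"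
  by (simp add: madd_def fun_eq_iff)

lemma mzero_eq_0: "mzero = 0"
  by (simp add: mzero_def fun_eq_iff)

lemma vsub_eq_minus: "vsub v w = v - w"
  by (simp add: vsub_def fun_eq_iff)

lemma vzero_eq_0: "vzero = 0"
  by (simp add: vzero_def fun_eq_iff)

lemma mmul_add_left: "mmul m n N (A + B) D = mmul m n N A D + mmul m n N B D"
  by (simp add: mmul_def fun_eq_iff distrib_right sum.distrib)

lemma mmul_add_right: "mmul m n N A (B + D) = mmul m n N A B + mmul m n N A D"
  by (simp add: mmul_def fun_eq_iff distrib_left sum.distrib)

lemma mmul_diff_left: "mmul m n N (A - B) D = mmul m n N A D - mmul m n N B D"
  by (simp add: mmul_def fun_eq_iff left_diff_distrib sum_subtractf)

lemma mmul_diff_right: "mmul m n N A (B - D) = mmul m n N A B - mmul m n N A D"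
  by (simp add: mmul_def fun_eq_iff right_diff_distrib sum_subtractf)

lemma mmul_zero_left [simp]: "mmul m n N 0 A = 0"
  by (simp add: mmul_def fun_eq_iff)

lemma mmul_zero_right [simp]: "mmul m n N A 0 = 0"
  by (simp add: mmul_def fun_eq_iff)

lemma mmul_msmul_left: "mmul m n N (msmul c A) B = msmul c (mmul m n N A B)"
  by (simp add: mmul_def msmul_def fun_eq_iff sum_distrib_left mult_ac)

lemma mmul_msmul_right: "mmul m n N A (msmul c B) = msmul c (mmul m n N A B)"
  by (simp add: mmul_def msmul_def fun_eq_iff sum_distrib_left mult_ac)

lemma msmul_zero [simp]: "msmul c 0 = 0"
  by (simp add: msmul_def fun_eq_iff)

lemma msmul_diff: "msmul c (A - B) = msmul c A - msmul c B"
  by (simp add: msmul_def fun_eq_iff right_diff_distrib)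

lemma mmul_assoc: "mmul m n N (mmul m n N A B) D = mmul m n N A (mmul m n N B D)"
proof (intro ext)
  fix x z
  have "mmul m n N (mmul m n N A B) D x z = (\<Sum>y\<in>idxs m n N. \<Sum>w\<in>idxs m n N. A x w * (B w y * D y z))"
    by (simp add: mmul_def sum_distrib_right mult.assoc)
  also have "\<dots> = mmul m n N A (mmul m n N B D) x z"
    unfolding mmul_def sum_distrib_left by (rule sum.swap)
  finally show "mmul m n N (mmul m n N A B) D x z = mmul m n N A (mmul m n N B D) x z" .
qed

lemma app_mmul: "app m n N (mmul m n N A B) v = app m n N A (app m n N B v)"
proof (intro ext)
  fix x
  have "app m n N (mmul m n N A B) v x = (\<Sum>y\<in>idxs m n N. \<Sum>w\<in>idxs m n N. A x w * (B w y * v y))"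
    by (simp add: mmul_def app_def sum_distrib_right mult.assoc)
  also have "\<dots> = app m n N A (app m n N B v) x"
    unfolding app_def sum_distrib_left by (rule sum.swap)
  finally show "app m n N (mmul m n N A B) v x = app m n N A (app m n N B v) x" .
qed

lemma app_add: "app m n N A (v + w) = app m n N A v + app m n N A w"
  by (simp add: app_def fun_eq_iff distrib_left sum.distrib)

lemma app_zero_mat [simp]: "app m n N 0 v = 0"
  by (simp add: app_def fun_eq_iff)

lemma mats_iff: "A \<in> mats m n N \<longleftrightarrow> (\<forall>x y. x \<notin> idxs m n N \<or> y \<notin> idxs m n N \<longrightarrow> A x y = 0)"
  by (auto simp: mats_def simp del: split_paired_All)

lemma unit_vecs: "y \<in> idxs m n N \<Longrightarrow> (\<lambda>x. of_bool (x = y)) \<in> vecs m n N"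
  by (auto simp: vecs_def)

lemma app_unit: "y \<in> idxs m n N \<Longrightarrow> app m n N A (\<lambda>x. of_bool (x = y)) x = A x y"
  by (simp add: app_def of_bool_def if_distrib cong: if_cong)

lemma mats_eqI:
  assumes A: "A \<in> mats m n N" and B: "B \<in> mats m n N"
    and eq: "\<And>v. v \<in> vecs m n N \<Longrightarrow> app m n N A v = app m n N B v"
  shows "A = B"
proof (intro ext)
  fix x y
  show "A x y = B x y"
  proof (cases "y \<in> idxs m n N")
    case True
    then show ?thesis
      using eq[OF unit_vecs[OF True]] app_unit[OF True] by metis
  next
    case False
    then show ?thesis
      using A B by (simp add: mats_iff del: split_paired_All)
  qed
qed

lemma mats_add: "A \<in> mats m n N \<Longrightarrow> B \<in> mats m n N \<Longrightarrow> A + B \<in> mats m n N"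
  by (simp add: mats_iff del: split_paired_All)

lemma mats_diff: "A \<in> mats m n N \<Longrightarrow> B \<in> mats m n N \<Longrightarrow> A - B \<in> mats m n N"
  by (simp add: mats_iff del: split_paired_All)

lemma mats_zero: "0 \<in> mats m n N"
  by (simp add: mats_iff)

lemma mats_msmul: "A \<in> mats m n N \<Longrightarrow> msmul c A \<in> mats m n N"
  by (simp add: mats_iff msmul_def del: split_paired_All)

lemma mats_mmul: "A \<in> mats m n N \<Longrightarrow> B \<in> mats m n N \<Longrightarrow> mmul m n N A B \<in> mats m n N"
  by (auto simp add: mats_iff mmul_def simp del: split_paired_All)

lemma mats_ident: "ident m n N \<in> mats m n N"
  by (auto simp: mats_iff ident_def)

lemma mmul_ident_left: "A \<in> mats m n N \<Longrightarrow> mmul m n N (ident m n N) A = A"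
proof (intro ext)
  fix x y assume A: "A \<in> mats m n N"
  have "mmul m n N (ident m n N) A x y = (\<Sum>z\<in>idxs m n N. if z = x then A z y else 0)"
    unfolding mmul_def ident_def by (intro sum.cong) auto
  then show "mmul m n N (ident m n N) A x y = A x y"
    using A by (simp add: mats_iff del: split_paired_All)
qed

lemma mmul_ident_right: "A \<in> mats m n N \<Longrightarrow> mmul m n N A (ident m n N) = A"
proof (intro ext)
  fix x y assume A: "A \<in> mats m n N"
  have "mmul m n N A (ident m n N) x y = (\<Sum>z\<in>idxs m n N. if z = y then A x z else 0)"
    unfolding mmul_def ident_def by (intro sum.cong) auto
  then show "mmul m n N A (ident m n N) x y = A x y"
    using A by (simp add: mats_iff del: split_paired_All)
qed

lemma Cmn_mats: "A \<in> Cmn m n N \<Longrightarrow> A \<in> mats m n N"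
  by (simp add: Cmn_def)

lemma Cmn_commute:
  "A \<in> Cmn m n N \<Longrightarrow> (g, h) \<in> GL N \<Longrightarrow>
    mmul m n N A (rho m n N g h) = mmul m n N (rho m n N g h) A"
  by (auto simp: Cmn_def)

lemma CmnI:
  assumes "A \<in> mats m n N"
    and "\<And>g h. (g, h) \<in> GL N \<Longrightarrow> mmul m n N A (rho m n N g h) = mmul m n N (rho m n N g h) A"
  shows "A \<in> Cmn m n N"
  using assms by (auto simp: Cmn_def)

lemma Cmn_add: "A \<in> Cmn m n N \<Longrightarrow> B \<in> Cmn m n N \<Longrightarrow> A + B \<in> Cmn m n N"
  by (intro CmnI) (simp_all add: Cmn_mats mats_add mmul_add_left mmul_add_right Cmn_commute)

lemma Cmn_diff: "A \<in> Cmn m n N \<Longrightarrow> B \<in> Cmn m n N \<Longrightarrow> A - B \<in> Cmn m n N"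
  by (intro CmnI) (simp_all add: Cmn_mats mats_diff mmul_diff_left mmul_diff_right Cmn_commute)

lemma Cmn_zero: "0 \<in> Cmn m n N"
  by (intro CmnI) (simp_all add: mats_zero)

lemma Cmn_msmul: "A \<in> Cmn m n N \<Longrightarrow> msmul c A \<in> Cmn m n N"
  by (intro CmnI) (simp_all add: Cmn_mats mats_msmul mmul_msmul_left mmul_msmul_right Cmn_commute)

lemma Cmn_mmul: "A \<in> Cmn m n N \<Longrightarrow> B \<in> Cmn m n N \<Longrightarrow> mmul m n N A B \<in> Cmn m n N"
  by (intro CmnI) (simp_all add: Cmn_mats mats_mmul,
      metis Cmn_commute mmul_assoc)

lemma Cmn_ident: "ident m n N \<in> Cmn m n N"
  by (intro CmnI) (simp_all add: mats_ident rho_mats mmul_ident_left mmul_ident_right)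

section \<open>The traceless projector\<close>

text \<open>The columns of \<open>P\<close> are the \<open>V0\<close>-components of the basis
  vectors; the two required properties then extend by linearity.\<close>

lemma traceless_projector_ex:
  "\<exists>P\<in>mats m n N. \<forall>v\<in>vecs m n N. app m n N P v \<in> V0 m n N \<and> v - app m n N P v \<in> V1 m n N"
proof -
  define e where "e y = (\<lambda>x. of_bool (x = y) :: complex)" for y :: idx
  have "\<forall>y\<in>idxs m n N. \<exists>u. u \<in> V1 m n N \<and> e y - u \<in> V0 m n N"
    using V0_V1_decomposition unit_vecs unfolding e_def by blast
  then obtain u where u: "\<And>y. y \<in> idxs m n N \<Longrightarrow> u y \<in> V1 m n N"
      "\<And>y. y \<in> idxs m n N \<Longrightarrow> e y - u y \<in> V0 m n N"
    by (metis (no_types))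
  define P where "P = (\<lambda>x y. if y \<in> idxs m n N then e y x - u y x else 0)"
  have "P x y = 0" if "x \<notin> idxs m n N \<or> y \<notin> idxs m n N" for x y
    using that V0_vecs[OF u(2)[of y]] by (auto simp: P_def vecs_def simp del: split_paired_All)
  then have P: "P \<in> mats m n N" by (simp add: mats_iff)
  have "app m n N P v \<in> V0 m n N \<and> v - app m n N P v \<in> V1 m n N" if v: "v \<in> vecs m n N" for v
  proof
    have Pv: "app m n N P v = (\<Sum>y\<in>idxs m n N. cscale (v y) (e y - u y))"
      by (auto simp: fun_eq_iff app_def P_def sum_fun_eq cscale_def intro!: sum.cong)
    then show "app m n N P v \<in> V0 m n N"
      using u(2) subspace_V0
      by (auto intro!: cscale.subspace_sum cscale.subspace_scale)
    have "v = (\<Sum>y\<in>idxs m n N. cscale (v y) (e y))"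
    proof
      fix x
      have "(\<Sum>y\<in>idxs m n N. v y * e y x) = (\<Sum>y\<in>idxs m n N. if y = x then v y else 0)"
        unfolding e_def by (intro sum.cong) auto
      then show "v x = (\<Sum>y\<in>idxs m n N. cscale (v y) (e y)) x"
        using v by (simp add: sum_fun_eq cscale_def vecs_def del: split_paired_All)
    qed
    then have "v - app m n N P v
        = (\<Sum>y\<in>idxs m n N. cscale (v y) (e y)) - (\<Sum>y\<in>idxs m n N. cscale (v y) (e y - u y))"
      using Pv by simp
    also have "\<dots> = (\<Sum>y\<in>idxs m n N. cscale (v y) (u y))"
      by (simp add: sum_subtractf[symmetric] cscale.scale_right_diff_distrib)
    finally show "v - app m n N P v \<in> V1 m n N"
      using u(1) subspace_V1
      by (auto intro!: cscale.subspace_sum cscale.subspace_scale)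
  qed
  then show ?thesis using P by blast
qed

text \<open>Discharges the definite description in \<open>Pmn_def\<close>: two candidates differ on
  each vector by an element of both \<open>V0\<close> and \<open>V1\<close>.\<close>

lemma Pmn:
  shows Pmn_mats: "Pmn m n N \<in> mats m n N"
    and app_Pmn_V0: "\<And>v. v \<in> vecs m n N \<Longrightarrow> app m n N (Pmn m n N) v \<in> V0 m n N"
    and diff_app_Pmn_V1: "\<And>v. v \<in> vecs m n N \<Longrightarrow> v - app m n N (Pmn m n N) v \<in> V1 m n N"
proof -
  let ?Q = "\<lambda>P. P \<in> mats m n N \<and> (\<forall>v\<in>vecs m n N. app m n N P v \<in> V0 m n N \<and> v - app m n N P v \<in> V1 m n N)"
  have "\<exists>!P. ?Q P"
  proof (rule ex_ex1I)
    show "\<exists>P. ?Q P" using traceless_projector_ex by blast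
    fix P P' assume P: "?Q P" and P': "?Q P'"
    show "P = P'"
    proof (rule mats_eqI)
      fix v assume v: "v \<in> vecs m n N"
      have "app m n N P v - app m n N P' v \<in> V0 m n N"
        using P P' v by (blast intro: cscale.subspace_diff subspace_V0)
      moreover have "app m n N P v - app m n N P' v = (v - app m n N P' v) - (v - app m n N P v)"
        by simp
      then have "app m n N P v - app m n N P' v \<in> V1 m n N"
        using P P' v by (metis cscale.subspace_diff subspace_V1)
      ultimately show "app m n N P v = app m n N P' v"
        using V0_V1_disjoint by fastforce
    qed (use P P' in auto)
  qed
  then have "?Q (Pmn m n N)"
    unfolding Pmn_def vsub_eq_minus by (rule theI')
  then show "Pmn m n N \<in> mats m n N"
    "\<And>v. v \<in> vecs m n N \<Longrightarrow> app m n N (Pmn m n N) v \<in> V0 m n N"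
    "\<And>v. v \<in> vecs m n N \<Longrightarrow> v - app m n N (Pmn m n N) v \<in> V1 m n N"
    by blast+
qed

lemma app_Pmn_if_V0:
  assumes "v \<in> V0 m n N"
  shows "app m n N (Pmn m n N) v = v"
proof -
  have "v - app m n N (Pmn m n N) v \<in> V0 m n N" "v - app m n N (Pmn m n N) v \<in> V1 m n N"
    using assms V0_vecs app_Pmn_V0 diff_app_Pmn_V1 cscale.subspace_diff[OF subspace_V0] by blast+
  then show ?thesis using V0_V1_disjoint by fastforce
qed

lemma app_Pmn_if_V1:
  assumes "v \<in> V1 m n N"
  shows "app m n N (Pmn m n N) v = 0"
proof -
  have "v - (v - app m n N (Pmn m n N) v) \<in> V1 m n N"
    using assms V1_vecs diff_app_Pmn_V1 cscale.subspace_diff[OF subspace_V1] by blast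
  then have "app m n N (Pmn m n N) v \<in> V1 m n N" by simp
  then show ?thesis
    using V0_V1_disjoint app_Pmn_V0[OF V1_vecs[OF assms]] by blast
qed

lemma Pmn_idem: "mmul m n N (Pmn m n N) (Pmn m n N) = Pmn m n N"
  by (rule mats_eqI[where m = m and n = n and N = N]) (simp_all add: Pmn_mats mats_mmul app_mmul app_Pmn_if_V0 app_Pmn_V0)

text \<open>By duality \<open>M\<close> preserves both summands, and an operator preserving both
  summands commutes with the projection.\<close>

lemma Pmn_commute_if_preserves:
  assumes M: "M \<in> mats m n N"
    and V0: "\<And>v. v \<in> V0 m n N \<Longrightarrow> app m n N M v \<in> V0 m n N"
    and adj: "\<And>v. v \<in> V0 m n N \<Longrightarrow> app m n N (madj M) v \<in> V0 m n N"
  shows "mmul m n N (Pmn m n N) M = mmul m n N M (Pmn m n N)"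
proof (rule mats_eqI)
  fix v assume v: "v \<in> vecs m n N"
  define v0 where "v0 = app m n N (Pmn m n N) v"
  define v1 where "v1 = v - v0"
  have mem: "v0 \<in> V0 m n N" "v1 \<in> V1 m n N" and v_eq: "v = v0 + v1"
    using app_Pmn_V0[OF v] diff_app_Pmn_V1[OF v] by (simp_all add: v0_def v1_def)
  have "app m n N (Pmn m n N) (app m n N M v)
      = app m n N (Pmn m n N) (app m n N M v0) + app m n N (Pmn m n N) (app m n N M v1)"
    unfolding v_eq app_add ..
  also have "\<dots> = app m n N M v0"
    using app_Pmn_if_V0[OF V0[OF mem(1)]]
      app_Pmn_if_V1[OF V1_preserved_if_adjoint_preserves_V0[OF M adj mem(2)]] by simp
  finally show "app m n N (mmul m n N (Pmn m n N) M) v = app m n N (mmul m n N M (Pmn m n N)) v"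
    by (simp add: app_mmul v0_def)
qed (simp_all add: M Pmn_mats mats_mmul)

lemma Pmn_Cmn: "Pmn m n N \<in> Cmn m n N"
proof (rule CmnI[OF Pmn_mats])
  fix g h assume gh: "(g, h) \<in> GL N"
  show "mmul m n N (Pmn m n N) (rho m n N g h) = mmul m n N (rho m n N g h) (Pmn m n N)"
    using rho_preserves_V0[OF gh] rho_preserves_V0[OF GL_adjoint[OF gh]]
    by (intro Pmn_commute_if_preserves rho_mats) (simp_all add: madj_rho)
qed

lemma Pmn_central:
  assumes "M \<in> Cmn m n N"
  shows "mmul m n N (Pmn m n N) M = mmul m n N M (Pmn m n N)"
proof -
  obtain c where "diagram_sum m n N c M"
    using Cmn_diagram_sum_ex[OF assms] by blast
  then show ?thesis
    using diagram_sum_preserves_V0 diagram_sum_madj Cmn_mats[OF assms]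
    by (intro Pmn_commute_if_preserves) blast+
qed

text \<open>The image of \<open>P\<close> is \<open>V0\<close>, so annihilating \<open>V0\<close>
  becomes an equation inside the algebra.\<close>

lemma Jann_iff: "M \<in> Jann m n N \<longleftrightarrow> M \<in> Cmn m n N \<and> mmul m n N M (Pmn m n N) = 0"
proof
  assume M: "M \<in> Jann m n N"
  then have C: "M \<in> Cmn m n N" by (simp add: Jann_def)
  have "mmul m n N M (Pmn m n N) = 0"
  proof (rule mats_eqI)
    fix v assume "v \<in> vecs m n N"
    then show "app m n N (mmul m n N M (Pmn m n N)) v = app m n N 0 v"
      using M app_Pmn_V0 by (simp add: app_mmul Jann_def vzero_eq_0)
  qed (simp_all add: C Cmn_mats Pmn_mats mats_mmul mats_zero)
  then show "M \<in> Cmn m n N \<and> mmul m n N M (Pmn m n N) = 0" using C by simp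
next
  assume M: "M \<in> Cmn m n N \<and> mmul m n N M (Pmn m n N) = 0"
  have "app m n N M v = 0" if "v \<in> V0 m n N" for v
    using app_mmul[of m n N M "Pmn m n N" v] M that by (simp add: app_Pmn_if_V0)
  then show "M \<in> Jann m n N" using M by (simp add: Jann_def vzero_eq_0)
qed

section \<open>The splitting by a central idempotent\<close>

lemma coset_eq_iff:
  fixes x y :: "idx \<Rightarrow> idx \<Rightarrow> complex"
  assumes J: "0 \<in> J" "\<And>x y. x \<in> J \<Longrightarrow> y \<in> J \<Longrightarrow> x - y \<in> J"
  shows "coset J x = coset J y \<longleftrightarrow> x - y \<in> J"
proof
  assume "coset J x = coset J y"
  moreover have "x \<in> coset J x" using J(1) by (force simp: coset_def madd_eq_plus)
  ultimately obtain j where "x = y + j" "j \<in> J" by (auto simp: coset_def madd_eq_plus)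
  then show "x - y \<in> J" by simp
next
  have sub: "coset J x \<subseteq> coset J y" if "x - y \<in> J" for x y
  proof
    fix z assume "z \<in> coset J x"
    then obtain j where j: "z = x + j" "j \<in> J" by (auto simp: coset_def madd_eq_plus)
    have "(x - y) - (0 - j) \<in> J" using J that j by blast
    moreover have "z = y + ((x - y) - (0 - j))" using j by simp
    ultimately show "z \<in> coset J y" unfolding coset_def madd_eq_plus by blast
  qed
  assume xy: "x - y \<in> J"
  then have "0 - (x - y) \<in> J" using J by blast
  then have "y - x \<in> J" by simp
  then show "coset J x = coset J y" using xy by (intro equalityI sub)
qed

text \<open>The vanishing of mixed products makes the direct sum one of algebras. The quotient
  operations are expressed on arbitrary representatives \<open>a\<close> and \<open>b\<close>, which
  includes their being well defined, and the condition on the image of \<open>P\<close> makes the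
  isomorphism unital.\<close>

theorem theorem3p1:
  fixes m n N :: nat
  assumes "m \<ge> 1" and "n \<ge> 1" and "N \<ge> 1"
  defines "C \<equiv> Cmn m n N" and "J \<equiv> Jann m n N" and "P \<equiv> Pmn m n N"
  defines "PC \<equiv> {mmul m n N P x | x. x \<in> C}"
  shows "P \<in> C \<and> mmul m n N P P = P
    \<and> two_sided_ideal m n N PC C \<and> two_sided_ideal m n N J C
    \<and> (\<forall>M\<in>C. \<exists>!xj. fst xj \<in> PC \<and> snd xj \<in> J \<and> M = madd (fst xj) (snd xj))
    \<and> (\<forall>x\<in>PC. \<forall>j\<in>J. mmul m n N x j = mzero \<and> mmul m n N j x = mzero)
    \<and> (\<exists>\<phi>. bij_betw \<phi> PC (quot C J)
         \<and> \<phi> P = coset J (ident m n N)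
         \<and> (\<forall>x\<in>PC. \<forall>y\<in>PC. \<forall>a\<in>\<phi> x. \<forall>b\<in>\<phi> y.
              \<phi> (madd x y) = coset J (madd a b)
            \<and> \<phi> (mmul m n N x y) = coset J (mmul m n N a b))
         \<and> (\<forall>c. \<forall>x\<in>PC. \<forall>a\<in>\<phi> x. \<phi> (msmul c x) = coset J (msmul c a)))"
proof -
  note C_closed = Cmn_add[of _ m n N, folded C_def] Cmn_diff[of _ m n N, folded C_def]
    Cmn_zero[of m n N, folded C_def] Cmn_msmul[of _ m n N, folded C_def]
    Cmn_mmul[of _ m n N, folded C_def] Cmn_ident[of m n N, folded C_def]
    Pmn_Cmn[of m n N, folded C_def P_def]
  have idem: "mmul m n N P P = P"
    by (simp add: P_def Pmn_idem)
  have central: "mmul m n N P x = mmul m n N x P" if "x \<in> C" for x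
    using that by (simp add: C_def P_def Pmn_central)
  have J_iff: "x \<in> J \<longleftrightarrow> x \<in> C \<and> mmul m n N x P = 0" for x
    by (simp add: J_def C_def P_def Jann_iff)
  \<comment> \<open>With \<open>J_iff\<close>, both ideals become eigenspaces of multiplication by
    \<open>P\<close>, for the eigenvalues 1 and 0.\<close>
  have PC_iff: "x \<in> PC \<longleftrightarrow> x \<in> C \<and> mmul m n N P x = x" for x
  proof
    assume "x \<in> PC"
    then obtain y where "x = mmul m n N P y" "y \<in> C" by (auto simp: PC_def)
    then show "x \<in> C \<and> mmul m n N P x = x"
      by (simp add: C_closed mmul_assoc[symmetric] idem)
  qed (metis (mono_tags, lifting) PC_def mem_Collect_eq)
  have PC_ideal: "two_sided_ideal m n N PC C"
    unfolding two_sided_ideal_def madd_eq_plus mzero_eq_0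
  proof (intro conjI ballI allI)
    fix x y assume x: "x \<in> PC" and y: "y \<in> C"
    then show "mmul m n N x y \<in> PC" by (simp add: PC_iff C_closed mmul_assoc[symmetric])
    have "mmul m n N P (mmul m n N y x) = mmul m n N y (mmul m n N P x)"
      using central[OF y] by (simp add: mmul_assoc[symmetric])
    then show "mmul m n N y x \<in> PC" using x y by (simp add: PC_iff C_closed)
  qed (auto simp: PC_iff C_closed mmul_add_right mmul_msmul_right)
  have J_ideal: "two_sided_ideal m n N J C"
    unfolding two_sided_ideal_def madd_eq_plus mzero_eq_0
  proof (intro conjI ballI allI)
    fix x y assume x: "x \<in> J" and y: "y \<in> C"
    have "mmul m n N (mmul m n N x y) P = mmul m n N (mmul m n N x P) y"
      using central[OF y] by (simp add: mmul_assoc)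
    then show "mmul m n N x y \<in> J" using x y by (simp add: J_iff C_closed)
    show "mmul m n N y x \<in> J" using x y by (simp add: J_iff C_closed mmul_assoc)
  qed (auto simp: J_iff C_closed mmul_add_left mmul_msmul_left)
  have J_diff: "x - y \<in> J" if "x \<in> J" "y \<in> J" for x y
    using that by (simp add: J_iff C_closed mmul_diff_left)
  have J_0: "0 \<in> J" by (simp add: J_iff C_closed)
  note coset_iff = coset_eq_iff[of J, OF J_0 J_diff]
  have J_compl: "M - mmul m n N P M \<in> J" if "M \<in> C" for M
    using that central by (simp add: J_iff C_closed mmul_diff_left mmul_assoc idem)
  have PJ: "mmul m n N P j = 0" if "j \<in> J" for j
    using that central by (simp add: J_iff)
  have decomp: "\<exists>!xj. fst xj \<in> PC \<and> snd xj \<in> J \<and> M = madd (fst xj) (snd xj)" if M: "M \<in> C" for M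
  proof (rule ex1I[of _ "(mmul m n N P M, M - mmul m n N P M)"])
    show "fst (mmul m n N P M, M - mmul m n N P M) \<in> PC
        \<and> snd (mmul m n N P M, M - mmul m n N P M) \<in> J
        \<and> M = madd (fst (mmul m n N P M, M - mmul m n N P M)) (snd (mmul m n N P M, M - mmul m n N P M))"
      using M J_compl[OF M] by (auto simp: PC_def madd_eq_plus)
    fix xj assume xj: "fst xj \<in> PC \<and> snd xj \<in> J \<and> M = madd (fst xj) (snd xj)"
    then have "mmul m n N P M = fst xj"
      by (simp add: madd_eq_plus mmul_add_right PJ PC_iff)
    then show "xj = (mmul m n N P M, M - mmul m n N P M)"
      using xj by (simp add: madd_eq_plus prod_eq_iff)
  qed
  have annih: "mmul m n N x j = 0 \<and> mmul m n N j x = 0" if x: "x \<in> PC" and j: "j \<in> J" for x j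
  proof -
    have "mmul m n N j x = mmul m n N (mmul m n N j P) x"
      using x by (simp add: PC_iff mmul_assoc)
    moreover have "mmul m n N x j = mmul m n N x (mmul m n N P j)"
      using x central[of x] by (metis PC_iff mmul_assoc)
    ultimately show ?thesis using j PJ[OF j] by (simp add: J_iff)
  qed
  \<comment> \<open>The isomorphism is the quotient map restricted to \<open>PC\<close>:
    \<open>P\<close> fixes \<open>PC\<close> and kills \<open>J\<close>, which gives injectivity,
    and \<open>M\<close> and its product with \<open>P\<close> lie in the same coset, which gives
    surjectivity.\<close>
  have bij: "bij_betw (coset J) PC (quot C J)"
    unfolding bij_betw_def
  proof
    show "inj_on (coset J) PC"
    proof (rule inj_onI)
      fix x y assume x: "x \<in> PC" and y: "y \<in> PC" and "coset J x = coset J y"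
      then have "mmul m n N P (x - y) = 0" using PJ coset_iff by blast
      then show "x = y" using x y by (simp add: PC_iff mmul_diff_right)
    qed
    show "coset J ` PC = quot C J"
    proof
      show "coset J ` PC \<subseteq> quot C J" by (auto simp: quot_def PC_iff)
      show "quot C J \<subseteq> coset J ` PC"
      proof
        fix K assume "K \<in> quot C J"
        then obtain M where M: "M \<in> C" "K = coset J M" by (auto simp: quot_def)
        then have "K = coset J (mmul m n N P M)" using J_compl coset_iff by simp
        then show "K \<in> coset J ` PC" using M by (auto simp: PC_def)
      qed
    qed
  qed
  have unit: "coset J P = coset J (ident m n N)"
  proof -
    have "P \<in> mats m n N" by (simp add: P_def Pmn_mats)
    then have "P - ident m n N \<in> J"
      by (simp add: J_iff C_closed mmul_diff_left idem mmul_ident_left)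
    then show ?thesis by (simp add: coset_iff)
  qed
  have rep: "a \<in> C \<and> a - x \<in> J" if "x \<in> PC" "a \<in> coset J x" for a x
    using that by (auto simp: coset_def madd_eq_plus PC_iff J_iff C_closed)
  have hom: "coset J (madd x y) = coset J (madd a b)
      \<and> coset J (mmul m n N x y) = coset J (mmul m n N a b)"
    if xy: "x \<in> PC" "y \<in> PC" and ab: "a \<in> coset J x" "b \<in> coset J y" for x y a b
  proof -
    have a: "a \<in> C" "a - x \<in> J" and b: "b \<in> C" "b - y \<in> J"
      using rep xy ab by blast+
    have y: "y \<in> C" using xy by (simp add: PC_iff)
    have J_add: "u + v \<in> J" if "u \<in> J" "v \<in> J" for u v
      using J_ideal that by (simp add: two_sided_ideal_def madd_eq_plus)
    have "(a + b) - (x + y) = (a - x) + (b - y)" by simp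
    then have "(a + b) - (x + y) \<in> J" using J_add a b by metis
    \<comment> \<open>The usual splitting: both terms lie in \<open>J\<close> because it is a
      two-sided ideal.\<close>
    moreover have "mmul m n N a b - mmul m n N x y = mmul m n N a (b - y) + mmul m n N (a - x) y"
      by (simp add: mmul_diff_left mmul_diff_right)
    then have "mmul m n N a b - mmul m n N x y \<in> J"
      using J_add a b y J_ideal by (simp add: two_sided_ideal_def)
    ultimately show ?thesis
      using coset_iff by (metis madd_eq_plus)
  qed
  have scal: "coset J (msmul c x) = coset J (msmul c a)" if "x \<in> PC" "a \<in> coset J x" for c x a
  proof -
    have "msmul c a - msmul c x \<in> J"
      using rep[OF that] J_ideal by (simp add: two_sided_ideal_def msmul_diff[symmetric])
    then show ?thesis using coset_iff by metis
  qed
  show ?thesis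
    using C_closed(7) idem PC_ideal J_ideal decomp annih bij unit hom scal
    unfolding mzero_eq_0 by (intro conjI exI[of _ "coset J"]) blast+
qed

end
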